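(* Let $\mathcal{P}=\mathbb{F}_q[x_1,\dots,x_n]$ and $G=G(m,a,n)$. The ring of coinvariants $\mathcal{P}_G$ of $G(m,a,n)$ has a block basis if and only if $a=1$. Moreover, if $a=1$, the monomial $x_1^{mn-1}x_2^{m(n-1)-1}\cdots x_n^{m-1}$ generates a block basis for $\mathcal{P}_G$, with products given in $\mathcal{P}_G$ (for $1\leq r\leq n$) by $$x_{n+1-r}^{mr}=-\sum_{\substack{j_1+\cdots+j_{n+1-r}=r\\ j_{n+1-r}\neq r}} x_1^{mj_1}\cdots x_{n+1-r}^{mj_{n+1-r}},$$ where the sum is over tuples $(j_1,\dots,j_{n+1-r})$ of nonnegative integers.
   Context: Here $q$ is a power of a prime, $m,a,n$ are positive integers with $a\mid m$, and $G(m,a,n)\cong S_n\ltimes A(m,a,n)$ is the imprimitive reflection group, where $S_n$ is the group of permutation matrices and $A(m,a,n)=\{\operatorname{diag}(w_1,\dots,w_n)\mid w_j^m=(w_1\cdots w_n)^{m/a}=1\}$. It is regarded as a subgroup of $\operatorname{GL}_n(q)$ acting on $\mathcal{P}$ by algebra automorphisms extending the linear action on $\langle x_1,\dots,x_n\rangle_{\mathbb{F}_q}=\mathbb{F}_q^n$, and its invariant ring is $\mathcal{P}^{G}=\mathbb{F}_q[e_1,\dots,e_n]$ with $e_i=\sum_{1\le j_1<\cdots<j_i\le n}x_{j_1}^m\cdots x_{j_i}^m$ for $i\neq n$ and $e_n=(x_1\cdots x_n)^{m/a}$. The ring of coinvariants is $\mathcal{P}_G=\mathcal{P}/\mathcal{I}$,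 where $\mathcal{I}$ is the ideal of $\mathcal{P}$ generated by the homogeneous elements of $\mathcal{P}^G$ of positive degree, i.e. by $e_1,\dots,e_n$. A monomial $f$ in $x_1,\dots,x_n$ generates a block basis for $\mathcal{P}_G$ if the set of all monomial factors (monic monomial divisors) of $f$ projects to an $\mathbb{F}_q$-vector space basis of $\mathcal{P}/\mathcal{I}$; such a basis is called a block basis.
   Formalization: The case n=1, a>1 is excluded: there the ideal is (x_1^{m/a}) and x_1^{m/a-1} generates a block basis though a≠1, so the equivalence fails. That G(m,a,n) is a subgroup of GL_n(q) is stated as m | q-1. *)

theory Defs
  imports
    "HOL-Algebra.QuotRing"
    "HOL-Algebra.Divisibility"
    "HOL-Algebra.Embedded_Algebras"
    "HOL-Combinatorics.Permutations"
    "HOL-Library.Poly_Mapping"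
    "HOL-Library.FuncSet"
    "Jordan_Normal_Form.Matrix"
begin

text \<open>
  A polynomial is a finitely supported map from exponent vectors to coefficients. The variable
  \<open>x\<^sub>i\<close> has index \<open>i\<close>; the ring in \<open>n\<close> variables is cut out as a carrier, with indices \<open>1, \<dots>, n\<close>.
\<close>

type_synonym 'a mpol = "(nat \<Rightarrow>\<^sub>0 nat) \<Rightarrow>\<^sub>0 'a"

definition Const :: "'a \<Rightarrow> 'a::comm_ring_1 mpol" where
  "Const c = Poly_Mapping.single 0 c"

definition X :: "nat \<Rightarrow> 'a::comm_ring_1 mpol" where
  "X i = Poly_Mapping.single (Poly_Mapping.single i 1) 1"

definition mpol_ring :: "nat \<Rightarrow> 'a::comm_ring_1 mpol ring" where
  "mpol_ring n =
     \<lparr> carrier = {p. \<forall>t\<in>Poly_Mapping.keys p. Poly_Mapping.keys t \<subseteq> {1..n}},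
       monoid.mult = (*), one = 1, zero = 0, add = (+) \<rparr>"

definition subst :: "(nat \<Rightarrow> 'a mpol) \<Rightarrow> 'a::comm_ring_1 mpol \<Rightarrow> 'a mpol" where
  "subst s p = (\<Sum>t\<in>Poly_Mapping.keys p. Const (Poly_Mapping.lookup p t) *
                  (\<Prod>i\<in>Poly_Mapping.keys t. s i ^ Poly_Mapping.lookup t i))"

text \<open>
  Matrices are indexed from \<open>0\<close>. Under the identification of \<open>x\<^sub>j\<close> with the \<open>j\<close>-th standard basis
  vector, a matrix sends \<open>x\<^sub>j\<close> to the linear form given by its \<open>j\<close>-th column.
\<close>

definition mat_act :: "nat \<Rightarrow> 'a mat \<Rightarrow> 'a::comm_ring_1 mpol \<Rightarrow> 'a mpol" where
  "mat_act n g = subst (\<lambda>j. \<Sum>i\<in>{1..n}. Const (g $$ (i - 1, j - 1)) * X i)"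

definition perm_matrices :: "nat \<Rightarrow> 'a::comm_ring_1 mat set" where
  "perm_matrices n =
     {Matrix.mat n n (\<lambda>(i, j). if i = \<pi> j then 1 else 0) | \<pi>. \<pi> permutes {..<n}}"

definition diag_group :: "nat \<Rightarrow> nat \<Rightarrow> nat \<Rightarrow> 'a::comm_ring_1 mat set" where
  "diag_group m a n =
     {mat_diag n w | w. (\<forall>j<n. w j ^ m = 1) \<and> (\<Prod>j<n. w j) ^ (m div a) = 1}"

text \<open>
  The imprimitive reflection group as the internal semidirect product inside the invertible
  matrices. This is the intended group when the coefficient field contains all \<open>m\<close>-th roots of
  unity, i.e. when \<open>m\<close> divides \<open>q - 1\<close>.
\<close>

definition imprim_group :: "nat \<Rightarrow> nat \<Rightarrow> nat \<Rightarrow> 'a::comm_ring_1 mat set" where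
  "imprim_group m a n = {S * D | S D. S \<in> perm_matrices n \<and> D \<in> diag_group m a n}"

definition invariants :: "nat \<Rightarrow> 'a mat set \<Rightarrow> 'a::comm_ring_1 mpol set" where
  "invariants n G = {p \<in> carrier (mpol_ring n). \<forall>g\<in>G. mat_act n g p = p}"

definition mono_degree :: "(nat \<Rightarrow>\<^sub>0 nat) \<Rightarrow> nat" where
  "mono_degree t = (\<Sum>i\<in>Poly_Mapping.keys t. Poly_Mapping.lookup t i)"

definition homogeneous :: "nat \<Rightarrow> 'a::comm_ring_1 mpol \<Rightarrow> bool" where
  "homogeneous d p \<longleftrightarrow> (\<forall>t\<in>Poly_Mapping.keys p. mono_degree t = d)"

definition coinv_ideal :: "nat \<Rightarrow> nat \<Rightarrow> nat \<Rightarrow> 'a::comm_ring_1 mpol set" where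
  "coinv_ideal m a n =
     Idl\<^bsub>mpol_ring n\<^esub> {p \<in> invariants n (imprim_group m a n). \<exists>d>0. homogeneous d p}"

definition coinvariants :: "nat \<Rightarrow> nat \<Rightarrow> nat \<Rightarrow> 'a::comm_ring_1 mpol set ring" where
  "coinvariants m a n = mpol_ring n Quot coinv_ideal m a n"

definition coinv_class :: "nat \<Rightarrow> nat \<Rightarrow> nat \<Rightarrow> 'a::comm_ring_1 mpol \<Rightarrow> 'a mpol set" where
  "coinv_class m a n p = coinv_ideal m a n +>\<^bsub>mpol_ring n\<^esub> p"

text \<open>The coefficient field inside the ring of coinvariants, over which it is a vector space.\<close>

definition coinv_scalars :: "nat \<Rightarrow> nat \<Rightarrow> nat \<Rightarrow> 'a::comm_ring_1 mpol set set" where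
  "coinv_scalars m a n = range (\<lambda>c. coinv_class m a n (Const c))"

definition monomials :: "nat \<Rightarrow> 'a::comm_ring_1 mpol set" where
  "monomials n = {Poly_Mapping.single t 1 | t. Poly_Mapping.keys t \<subseteq> {1..n}}"

definition monomial_factors :: "nat \<Rightarrow> 'a::comm_ring_1 mpol \<Rightarrow> 'a mpol set" where
  "monomial_factors n f = {g \<in> monomials n. g divides\<^bsub>mpol_ring n\<^esub> f}"

text \<open>
  Bases are expressed through the list-based \<^const>\<open>ring.independent\<close> and \<^const>\<open>ring.Span\<close>;
  \<open>gs\<close> enumerates the monomial factors. Independence is that of the family of residue classes,
  so distinct factors must have distinct classes.
\<close>

definition generates_block_basis :: "nat \<Rightarrow> nat \<Rightarrow> nat \<Rightarrow> 'a::comm_ring_1 mpol \<Rightarrow> bool" where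
  "generates_block_basis m a n f \<longleftrightarrow>
     f \<in> monomials n \<and>
     (\<exists>gs. distinct gs \<and> set gs = monomial_factors n f \<and>
        ring.independent (coinvariants m a n) (coinv_scalars m a n) (map (coinv_class m a n) gs) \<and>
        ring.Span (coinvariants m a n) (coinv_scalars m a n) (map (coinv_class m a n) gs)
          = carrier (coinvariants m a n))"

definition tuples :: "nat \<Rightarrow> nat \<Rightarrow> (nat \<Rightarrow> nat) set" where
  "tuples k r = {j \<in> {1..k} \<rightarrow>\<^sub>E UNIV. (\<Sum>i\<in>{1..k}. j i) = r}"

lemma finite_tuples: "finite (tuples k r)"
proof (rule finite_subset)
  show "tuples k r \<subseteq> {1..k} \<rightarrow>\<^sub>E {..r}"
  proof
    fix j assume j: "j \<in> tuples k r"
    then have "j i \<le> r" if "i \<in> {1..k}" for i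
      using that member_le_sum[of i "{1..k}" j] by (simp add: tuples_def)
    with j show "j \<in> {1..k} \<rightarrow>\<^sub>E {..r}" by (simp add: tuples_def PiE_iff)
  qed
  show "finite ({1..k} \<rightarrow>\<^sub>E {..r})"
    by (intro finite_PiE) auto
qed

lemma cring_mpol_ring: "cring (mpol_ring n :: 'a::comm_ring_1 mpol ring)"
proof -
  let ?C = "carrier (mpol_ring n :: 'a mpol ring)"
  have add: "p + q \<in> ?C" if "p \<in> ?C" "q \<in> ?C" for p q
  proof -
    have "Poly_Mapping.keys t \<subseteq> {1..n}" if t: "t \<in> Poly_Mapping.keys (p + q)" for t
    proof -
      from t Poly_Mapping.keys_add[of p q]
      have "t \<in> Poly_Mapping.keys p \<or> t \<in> Poly_Mapping.keys q" by blast
      then show ?thesis using \<open>p \<in> ?C\<close> \<open>q \<in> ?C\<close> unfolding mpol_ring_def by auto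
    qed
    then show ?thesis by (simp add: mpol_ring_def)
  qed
  have uminus: "- p \<in> ?C" if "p \<in> ?C" for p
    using that by (auto simp: mpol_ring_def)
  have mult: "p * q \<in> ?C" if "p \<in> ?C" "q \<in> ?C" for p q
  proof -
    have "Poly_Mapping.keys t \<subseteq> {1..n}" if t: "t \<in> Poly_Mapping.keys (p * q)" for t
    proof -
      from t keys_mult[of p q] obtain u v where
        uv: "t = u + v" "u \<in> Poly_Mapping.keys p" "v \<in> Poly_Mapping.keys q" by blast
      then have "Poly_Mapping.keys u \<subseteq> {1..n}" "Poly_Mapping.keys v \<subseteq> {1..n}"
        using \<open>p \<in> ?C\<close> \<open>q \<in> ?C\<close> by (auto simp: mpol_ring_def)
      then show ?thesis using Poly_Mapping.keys_add[of u v] uv(1) by blast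
    qed
    then show ?thesis by (simp add: mpol_ring_def)
  qed
  have zero: "0 \<in> ?C" and one: "1 \<in> ?C"
    by (simp_all add: mpol_ring_def flip: single_one)
  have ops: "\<zero>\<^bsub>mpol_ring n\<^esub> = (0 :: 'a mpol)" "\<one>\<^bsub>mpol_ring n\<^esub> = (1 :: 'a mpol)"
    "p \<oplus>\<^bsub>mpol_ring n\<^esub> q = p + q" "p \<otimes>\<^bsub>mpol_ring n\<^esub> q = p * q" for p q :: "'a mpol"
    by (simp_all add: mpol_ring_def)
  show ?thesis
  proof (rule cringI)
    show "abelian_group (mpol_ring n :: 'a mpol ring)"
    proof (rule abelian_groupI)
      fix p assume "p \<in> ?C"
      then show "\<exists>q\<in>?C. q \<oplus>\<^bsub>mpol_ring n\<^esub> p = \<zero>\<^bsub>mpol_ring n\<^esub>"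
        using uminus[of p] by (intro bexI[of _ "- p"]) (simp_all add: ops)
    qed (simp_all add: ops add zero ac_simps)
    show "comm_monoid (mpol_ring n :: 'a mpol ring)"
      by (rule comm_monoidI) (simp_all add: ops mult one ac_simps)
  qed (simp add: ops distrib_right)
qed

lemma ideal_coinv_ideal: "ideal (coinv_ideal m a n) (mpol_ring n :: 'a::comm_ring_1 mpol ring)"
proof -
  interpret cring "mpol_ring n :: 'a mpol ring" by (rule cring_mpol_ring)
  show ?thesis unfolding coinv_ideal_def
    by (rule genideal_ideal) (auto simp: invariants_def)
qed

end

theory Submission
  imports Defs "HOL-Algebra.Multiplicative_Group" "HOL-Library.Disjoint_Sets"
begin

text \<open>
  The ideal \<open>\<I>\<close> is controlled through coefficients, without describing the invariant ring. Let
  \<open>a = 1\<close>. The complete homogeneous polynomial \<open>h\<^sub>r\<close> in the powers \<open>y\<^sub>i = x\<^sub>i\<^sup>m\<close> is invariant, and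
  \<open>h\<^sub>r\<^sub>+\<^sub>1(y\<^sub>1, \<dots>, y\<^sub>k\<^sub>+\<^sub>1) = h\<^sub>r\<^sub>+\<^sub>1(y\<^sub>1, \<dots>, y\<^sub>k) + y\<^sub>k\<^sub>+\<^sub>1 h\<^sub>r(y\<^sub>1, \<dots>, y\<^sub>k\<^sub>+\<^sub>1)\<close> pushes its truncation to the
  first \<open>k\<close> variables into \<open>\<I>\<close> as soon as \<open>r + k > n\<close>. For \<open>r + k = n + 1\<close> these are the product
  relations, and rewriting with them moves exponents to variables of smaller index, so the block
  monomials span. They are independent because the alternating sum of the coefficients at the
  permutations of the exponent of the generator \<open>f\<close> (up to the shift by one) is a linear functional that vanishes on \<open>\<I>\<close> and pairs the
  block monomials with their complements in \<open>f\<close> in a unitriangular way. If \<open>a > 1\<close>, then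
  \<open>(x\<^sub>1 \<cdots> x\<^sub>n)\<^sup>m\<^sup>/\<^sup>a \<in> \<I>\<close> forces some exponent of a generator of a block basis below \<open>m / a\<close>, whereas
  all elements of \<open>\<I>\<close> only have terms of degree greater than \<open>m / a\<close>, so that the next power of
  that variable cannot be reduced.
\<close>

section \<open>Coefficients of monomial multiples and products of monomials\<close>

abbreviation "lookup \<equiv> Poly_Mapping.lookup"
abbreviation "keys \<equiv> Poly_Mapping.keys"
abbreviation "single \<equiv> Poly_Mapping.single"

text \<open>Subtraction of exponents is truncated, so the guard is what makes \<open>t - u\<close> a
  genuine quotient of exponents. Ideal membership is later tested on coefficients of monomial
  multiples, always through this formula.\<close>

lemma lookup_single_mult:
  fixes p :: "'a::comm_ring_1 mpol"
  shows "lookup (single u c * p) t =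
    (if \<forall>i. lookup u i \<le> lookup t i then c * lookup p (t - u) else 0)"
proof -
  have "lookup (single u c * p) t = (\<Sum>l. (c * (\<Sum>q. lookup p q when t = l + q)) when l = u)"
    unfolding lookup_mult lookup_single by (rule Sum_any.cong) (auto simp: when_def)
  also have "\<dots> = c * (\<Sum>q. lookup p q when t = u + q)"
    by simp
  also have "(\<Sum>q. lookup p q when t = u + q) =
      (if \<forall>i. lookup u i \<le> lookup t i then lookup p (t - u) else 0)"
  proof (cases "\<forall>i. lookup u i \<le> lookup t i")
    case True
    then have "t = u + q \<longleftrightarrow> q = t - u" for q
      by (auto simp: poly_mapping_eq_iff fun_eq_iff lookup_add lookup_minus)
    with True show ?thesis by simp
  next
    case False
    then have "t \<noteq> u + q" for q by (auto simp: lookup_add)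
    with False show ?thesis by (simp only: when_def if_False Sum_any.neutral)
  qed
  finally show ?thesis by simp
qed

lemma sum_single_lookup:
  assumes "finite A" "keys p \<subseteq> A"
  shows "(\<Sum>t\<in>A. single t (lookup p t)) = p"
proof (rule poly_mapping_eqI)
  fix k
  show "lookup (\<Sum>t\<in>A. single t (lookup p t)) k = lookup p k"
    using assms by (auto simp: lookup_sum lookup_single when_def in_keys_iff)
qed

lemma sum_single_index:
  assumes "finite A"
  shows "lookup (\<Sum>i\<in>A. single i (c i)) k = (if k \<in> A then c k else 0)"
  using assms by (simp add: lookup_sum lookup_single when_def)

lemma lookup_map_key:
  "inj f \<Longrightarrow> lookup (Poly_Mapping.map_key f p) k = lookup p (f k)"
  by (simp add: map_key.rep_eq)

lemma power_single_single:
  "single (single i 1) (c :: 'a::comm_ring_1) ^ k = single (single i k) (c ^ k)"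
  by (induction k) (simp_all add: mult_single ac_simps flip: single_add)

lemma prod_single:
  fixes c :: "'b \<Rightarrow> 'a::comm_ring_1" and u :: "'b \<Rightarrow> nat \<Rightarrow>\<^sub>0 nat"
  shows "(\<Prod>i\<in>A. single (u i) (c i)) = single (\<Sum>i\<in>A. u i) (\<Prod>i\<in>A. c i)"
  by (induction A rule: infinite_finite_induct) (simp_all add: mult_single)

lemma Const_mult_X: "Const c * X i = single (single i 1) (c :: 'a::comm_ring_1)"
  by (simp add: Const_def X_def mult_single)

lemma X_power: "X i ^ k = (single (single i k) 1 :: 'a::comm_ring_1 mpol)"
  using power_single_single[of i "1::'a" k] by (simp add: X_def)

lemma mpol_ring_simps:
  "p \<in> carrier (mpol_ring n) \<longleftrightarrow> (\<forall>t\<in>keys p. keys t \<subseteq> {1..n})"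
  "\<zero>\<^bsub>mpol_ring n\<^esub> = 0" "\<one>\<^bsub>mpol_ring n\<^esub> = 1"
  "p \<oplus>\<^bsub>mpol_ring n\<^esub> q = p + q" "p \<otimes>\<^bsub>mpol_ring n\<^esub> q = p * q"
  by (simp_all add: mpol_ring_def)

section \<open>The group action read off on coefficients\<close>

text \<open>Merges the two factors of the semidirect product into one monomial matrix and moves
  permutation and weights from the matrix indices \<open>{..<n}\<close> to the variable indices
  \<open>{1..n}\<close>; the remaining \<open>Suc\<close> is the offset between the two.\<close>

lemma imprim_group_iff:
  fixes g :: "'a::comm_ring_1 mat"
  shows "g \<in> imprim_group m a n \<longleftrightarrow>
    (\<exists>\<sigma> w. \<sigma> permutes {1..n} \<and> (\<forall>j\<in>{1..n}. w j ^ m = 1) \<and> (\<Prod>j\<in>{1..n}. w j) ^ (m div a) = 1 \<and>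
      g = Matrix.mat n n (\<lambda>(i, j). if Suc i = \<sigma> (Suc j) then w (Suc j) else 0))" (is "_ \<longleftrightarrow> ?R")
proof
  assume "g \<in> imprim_group m a n"
  then obtain \<pi> w where \<pi>: "\<pi> permutes {..<n}"
    and w: "\<forall>j<n. w j ^ m = 1" "(\<Prod>j<n. w j) ^ (m div a) = 1"
    and g: "g = Matrix.mat n n (\<lambda>(i, j). if i = \<pi> j then 1 else 0) * mat_diag n w"
    by (auto simp: imprim_group_def perm_matrices_def diag_group_def)
  let ?\<sigma> = "map_permutation {..<n} Suc \<pi>" and ?w = "\<lambda>j. w (j - 1)"
  have "bij_betw Suc {..<n} {1..n}"
    by (simp add: bij_betw_def image_Suc_lessThan)
  with \<pi> have "?\<sigma> permutes {1..n}"
    by (intro map_permutation_permutes)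
  moreover have "?\<sigma> (Suc j) = Suc (\<pi> j)" if "j < n" for j
    using that by (intro map_permutation_apply) auto
  then have "g = Matrix.mat n n (\<lambda>(i, j). if Suc i = ?\<sigma> (Suc j) then ?w (Suc j) else 0)"
    unfolding g by (subst mat_diag_mult_right[of _ n]) (auto intro!: eq_matI)
  moreover have "\<forall>j\<in>{1..n}. ?w j ^ m = 1"
    using w(1) by auto
  moreover have "(\<Prod>j\<in>{1..n}. ?w j) ^ (m div a) = 1"
    using w(2) by (simp add: prod.atLeast1_atMost_eq)
  ultimately show ?R by (intro exI[of _ ?\<sigma>] exI[of _ ?w]) simp
next
  assume ?R
  then obtain \<sigma> w where \<sigma>: "\<sigma> permutes {1..n}"
    and w: "\<forall>j\<in>{1..n}. w j ^ m = 1" "(\<Prod>j\<in>{1..n}. w j) ^ (m div a) = 1"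
    and g: "g = Matrix.mat n n (\<lambda>(i, j). if Suc i = \<sigma> (Suc j) then w (Suc j) else 0)"
    by blast
  let ?p = "\<lambda>j::nat. j - 1" and ?w = "\<lambda>j. w (Suc j)"
  let ?\<pi> = "map_permutation {1..n} ?p \<sigma>"
  have inj: "inj_on ?p {1..n}" by (auto simp: inj_on_def)
  have "bij_betw ?p {1..n} {..<n}"
    by (rule bij_betwI[of _ _ _ Suc]) auto
  with \<sigma> have "?\<pi> permutes {..<n}"
    by (intro map_permutation_permutes)
  moreover have "i = ?\<pi> j \<longleftrightarrow> Suc i = \<sigma> (Suc j)" if "j < n" for i j
  proof -
    have "?\<pi> (?p (Suc j)) = ?p (\<sigma> (Suc j))"
      using that inj by (intro map_permutation_apply) auto
    moreover have "\<sigma> (Suc j) \<in> {1..n}"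
      using permutes_in_image[OF \<sigma>, of "Suc j"] that by simp
    ultimately show ?thesis by auto
  qed
  then have "g = Matrix.mat n n (\<lambda>(i, j). if i = ?\<pi> j then 1 else 0) * mat_diag n ?w"
    unfolding g by (subst mat_diag_mult_right[of _ n]) (auto intro!: eq_matI)
  moreover have "\<forall>j<n. ?w j ^ m = 1" "(\<Prod>j<n. ?w j) ^ (m div a) = 1"
    using w by (simp_all add: prod.atLeast1_atMost_eq)
  ultimately show "g \<in> imprim_group m a n"
    unfolding imprim_group_def perm_matrices_def diag_group_def by blast
qed

text \<open>The matrix sends \<open>X j\<close> to \<open>w j\<close> times
  \<open>X (\<sigma> j)\<close>, hence the monomial with exponent \<open>u\<close> to a multiple of
  the one with exponent \<open>u\<close> composed with the inverse of \<sigma>. Exactly one exponent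
  lands on \<open>t\<close>, namely \<open>t\<close> composed with \<sigma>, which is
  \<open>map_key \<sigma> t\<close>.\<close>

lemma lookup_mat_act:
  fixes p :: "'a::comm_ring_1 mpol"
  assumes \<sigma>: "\<sigma> permutes {1..n}" and p: "p \<in> carrier (mpol_ring n)"
    and g: "g = Matrix.mat n n (\<lambda>(i, j). if Suc i = \<sigma> (Suc j) then w (Suc j) else 0)"
  shows "lookup (mat_act n g p) t =
    (\<Prod>i\<in>{1..n}. w i ^ lookup t (\<sigma> i)) * lookup p (Poly_Mapping.map_key \<sigma> t)"
proof -
  define \<tau> where "\<tau> = Hilbert_Choice.inv \<sigma>"
  have \<tau>: "\<tau> permutes {1..n}" "\<tau> (\<sigma> i) = i" "\<sigma> (\<tau> i) = i" for i
    using \<sigma> permutes_inverses[OF \<sigma>] by (auto simp: \<tau>_def permutes_inv)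
  have inj: "inj \<sigma>" "inj \<tau>"
    using \<sigma> \<tau>(1) by (auto intro: permutes_inj)
  let ?s = "\<lambda>j. \<Sum>i\<in>{1..n}. Const (g $$ (i - 1, j - 1)) * X i :: 'a mpol"
  have s: "?s j = single (single (\<sigma> j) 1) (w j)" if "j \<in> {1..n}" for j
  proof -
    have "\<sigma> j \<in> {1..n}" using permutes_in_image[OF \<sigma>] that by blast
    have "?s j = (\<Sum>i\<in>{1..n}. if i = \<sigma> j then single (single (\<sigma> j) 1) (w j) else 0)"
      using that by (intro sum.cong refl) (auto simp: g Const_mult_X)
    also have "\<dots> = single (single (\<sigma> j) 1) (w j)"
      using \<open>\<sigma> j \<in> {1..n}\<close> by simp
    finally show ?thesis .
  qed
  have term_eq: "Const c * (\<Prod>i\<in>keys u. ?s i ^ lookup u i) =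
      single (Poly_Mapping.map_key \<tau> u) (c * (\<Prod>i\<in>{1..n}. w i ^ lookup u i))"
    if u: "keys u \<subseteq> {1..n}" for c u
  proof -
    have "(\<Prod>i\<in>keys u. ?s i ^ lookup u i) = (\<Prod>i\<in>{1..n}. ?s i ^ lookup u i)"
      using u by (intro prod.mono_neutral_left) (auto simp: in_keys_iff)
    also have "\<dots> = (\<Prod>i\<in>{1..n}. single (single (\<sigma> i) (lookup u i)) (w i ^ lookup u i))"
      by (intro prod.cong refl) (simp only: s power_single_single)
    also have "\<dots> = single (\<Sum>i\<in>{1..n}. single (\<sigma> i) (lookup u i)) (\<Prod>i\<in>{1..n}. w i ^ lookup u i)"
      by (rule prod_single)
    also have "(\<Sum>i\<in>{1..n}. single (\<sigma> i) (lookup u i)) = (\<Sum>i\<in>{1..n}. single i (lookup u (\<tau> i)))"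
      by (rule sum.permute[OF \<sigma>, of "\<lambda>i. single i (lookup u (\<tau> i))", symmetric, THEN trans[rotated]])
        (simp add: o_def \<tau>(2))
    also have "\<dots> = Poly_Mapping.map_key \<tau> u"
      using u permutes_not_in[OF \<tau>(1)]
      by (intro poly_mapping_eqI) (auto simp: sum_single_index lookup_map_key[OF inj(2)] in_keys_iff)
    finally show ?thesis by (simp add: Const_def mult_single)
  qed
  have "lookup (mat_act n g p) t = (\<Sum>u\<in>keys p.
      lookup (single (Poly_Mapping.map_key \<tau> u) (lookup p u * (\<Prod>i\<in>{1..n}. w i ^ lookup u i))) t)"
    unfolding mat_act_def subst_def lookup_sum
    using p by (intro sum.cong refl arg_cong[where f = "\<lambda>q. lookup q t"] term_eq) (auto simp: mpol_ring_simps)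
  also have "\<dots> = (\<Sum>u\<in>keys p. if u = Poly_Mapping.map_key \<sigma> t
      then (\<Prod>i\<in>{1..n}. w i ^ lookup t (\<sigma> i)) * lookup p (Poly_Mapping.map_key \<sigma> t) else 0)"
  proof (intro sum.cong refl)
    fix u
    have "Poly_Mapping.map_key \<tau> u = t \<longleftrightarrow> u = Poly_Mapping.map_key \<sigma> t"
      using \<tau>(2,3)
      by (auto simp: poly_mapping_eq_iff fun_eq_iff lookup_map_key[OF inj(1)] lookup_map_key[OF inj(2)]) metis+
    then show "lookup (single (Poly_Mapping.map_key \<tau> u) (lookup p u * (\<Prod>i\<in>{1..n}. w i ^ lookup u i))) t =
      (if u = Poly_Mapping.map_key \<sigma> t
       then (\<Prod>i\<in>{1..n}. w i ^ lookup t (\<sigma> i)) * lookup p (Poly_Mapping.map_key \<sigma> t) else 0)"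
      by (simp add: lookup_single when_def lookup_map_key[OF inj(1)] mult.commute)
  qed
  also have "\<dots> = (\<Prod>i\<in>{1..n}. w i ^ lookup t (\<sigma> i)) * lookup p (Poly_Mapping.map_key \<sigma> t)"
    by (auto simp: in_keys_iff)
  finally show ?thesis .
qed

text \<open>Removes matrices from the picture: from here on, invariance is used only as a family of
  equations between coefficients.\<close>

lemma invariants_imprim_group_iff:
  fixes p :: "'a::comm_ring_1 mpol"
  shows "p \<in> invariants n (imprim_group m a n) \<longleftrightarrow> p \<in> carrier (mpol_ring n) \<and>
    (\<forall>\<sigma> w t. \<sigma> permutes {1..n} \<longrightarrow> (\<forall>j\<in>{1..n}. w j ^ m = 1) \<longrightarrow> (\<Prod>j\<in>{1..n}. w j) ^ (m div a) = 1 \<longrightarrow>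
      (\<Prod>i\<in>{1..n}. w i ^ lookup t (\<sigma> i)) * lookup p (Poly_Mapping.map_key \<sigma> t) = lookup p t)"
proof -
  have "(\<forall>g\<in>imprim_group m a n. mat_act n g p = p) \<longleftrightarrow>
    (\<forall>\<sigma> w. \<sigma> permutes {1..n} \<longrightarrow> (\<forall>j\<in>{1..n}. w j ^ m = 1) \<longrightarrow> (\<Prod>j\<in>{1..n}. w j) ^ (m div a) = 1 \<longrightarrow>
      mat_act n (Matrix.mat n n (\<lambda>(i, j). if Suc i = \<sigma> (Suc j) then w (Suc j) else 0)) p = p)"
    unfolding Ball_def imprim_group_iff by blast
  also have "p \<in> carrier (mpol_ring n) \<Longrightarrow> \<dots> \<longleftrightarrow>
    (\<forall>\<sigma> w. \<sigma> permutes {1..n} \<longrightarrow> (\<forall>j\<in>{1..n}. w j ^ m = 1) \<longrightarrow> (\<Prod>j\<in>{1..n}. w j) ^ (m div a) = 1 \<longrightarrow>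
      (\<forall>t. (\<Prod>i\<in>{1..n}. w i ^ lookup t (\<sigma> i)) * lookup p (Poly_Mapping.map_key \<sigma> t) = lookup p t))"
    by (simp add: poly_mapping_eq_iff fun_eq_iff lookup_mat_act[OF _ _ refl] cong: imp_cong)
  finally have "p \<in> carrier (mpol_ring n) \<Longrightarrow> ?thesis"
    by (auto simp: invariants_def)
  then show ?thesis
    by (auto simp: invariants_def)
qed

section \<open>Block bases of the ring of coinvariants\<close>

lemma mpol_minus:
  assumes "p \<in> carrier (mpol_ring n)" "q \<in> carrier (mpol_ring n)"
  shows "p - q \<in> carrier (mpol_ring n)" "p \<ominus>\<^bsub>mpol_ring n\<^esub> q = (p - q :: 'a::comm_ring_1 mpol)"
proof -
  interpret cring "mpol_ring n :: 'a mpol ring" by (rule cring_mpol_ring)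
  have q: "- q \<in> carrier (mpol_ring n)"
    using assms(2) by (simp add: mpol_ring_simps)
  have "\<ominus>\<^bsub>mpol_ring n\<^esub> q = - q"
    using minus_equality[of "- q" q] q assms(2) by (simp add: mpol_ring_simps)
  then show "p \<ominus>\<^bsub>mpol_ring n\<^esub> q = p - q"
    by (simp add: a_minus_def mpol_ring_simps)
  then show "p - q \<in> carrier (mpol_ring n)"
    using minus_closed[OF assms] by simp
qed

text \<open>Negatives are multiples by \<open>- 1\<close>, so no separate closure condition appears.
  Meant for sets \<open>J\<close> cut out by conditions on coefficients, which are then compared
  with the coinvariant ideal through its minimality.\<close>

lemma ideal_mpol_ringI:
  assumes "J \<subseteq> carrier (mpol_ring n)" "0 \<in> J" "\<And>p q. p \<in> J \<Longrightarrow> q \<in> J \<Longrightarrow> p + q \<in> J"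
    and "\<And>p r. p \<in> J \<Longrightarrow> r \<in> carrier (mpol_ring n) \<Longrightarrow> r * p \<in> J"
  shows "ideal J (mpol_ring n :: 'a::comm_ring_1 mpol ring)"
proof -
  interpret cring "mpol_ring n :: 'a mpol ring" by (rule cring_mpol_ring)
  show ?thesis
  proof (rule idealI)
    show "subgroup J (add_monoid (mpol_ring n :: 'a mpol ring))"
    proof (rule add.subgroupI)
      fix p assume p: "p \<in> J"
      have "- 1 \<in> carrier (mpol_ring n :: 'a mpol ring)"
        by (simp add: mpol_ring_simps)
      from assms(4)[OF p this] have "0 - p \<in> J" by simp
      moreover have "\<ominus>\<^bsub>mpol_ring n\<^esub> p = 0 - p"
        using mpol_minus(2)[of 0 n p] subsetD[OF assms(1) p] zero_closed
        by (simp add: mpol_ring_simps(2,4) a_minus_def)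
      ultimately show "\<ominus>\<^bsub>mpol_ring n\<^esub> p \<in> J" by simp
    next
      show "J \<noteq> {}" using assms(2) by blast
    qed (use assms(1,3) in \<open>simp_all add: mpol_ring_simps(4)\<close>)
  next
    show "r \<otimes>\<^bsub>mpol_ring n\<^esub> p \<in> J" "p \<otimes>\<^bsub>mpol_ring n\<^esub> r \<in> J"
      if "p \<in> J" "r \<in> carrier (mpol_ring n)" for p r
      using assms(4)[OF that] by (simp_all add: mpol_ring_simps(5) mult.commute)
  qed (rule ring_axioms)
qed

lemma coinv_ideal_minimal:
  fixes J :: "'a::comm_ring_1 mpol set"
  assumes "ideal J (mpol_ring n)"
    and "\<And>p d. p \<in> invariants n (imprim_group m a n) \<Longrightarrow> d > 0 \<Longrightarrow> homogeneous d p \<Longrightarrow> p \<in> J"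
  shows "coinv_ideal m a n \<subseteq> J"
proof -
  interpret cring "mpol_ring n :: 'a mpol ring" by (rule cring_mpol_ring)
  show ?thesis unfolding coinv_ideal_def
    using assms(2) by (intro genideal_minimal[OF assms(1)]) auto
qed

lemma invariant_in_coinv_ideal:
  fixes p :: "'a::comm_ring_1 mpol"
  assumes "p \<in> invariants n (imprim_group m a n)" "d > 0" "homogeneous d p"
  shows "p \<in> coinv_ideal m a n"
proof -
  interpret cring "mpol_ring n :: 'a mpol ring" by (rule cring_mpol_ring)
  show ?thesis unfolding coinv_ideal_def
    by (rule subsetD[OF genideal_self]) (use assms in \<open>auto simp: invariants_def\<close>)
qed

lemma coinv_ideal_closed:
  fixes p q :: "'a::comm_ring_1 mpol"
  shows "coinv_ideal m a n \<subseteq> carrier (mpol_ring n :: 'a mpol ring)"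
    and "0 \<in> (coinv_ideal m a n :: 'a mpol set)"
    and "p \<in> coinv_ideal m a n \<Longrightarrow> q \<in> coinv_ideal m a n \<Longrightarrow> p + q \<in> coinv_ideal m a n"
    and "p \<in> coinv_ideal m a n \<Longrightarrow> q \<in> coinv_ideal m a n \<Longrightarrow> p - q \<in> coinv_ideal m a n"
    and "p \<in> coinv_ideal m a n \<Longrightarrow> r \<in> carrier (mpol_ring n) \<Longrightarrow> r * p \<in> coinv_ideal m a n"
proof -
  interpret I: ideal "coinv_ideal m a n" "mpol_ring n :: 'a mpol ring" by (rule ideal_coinv_ideal)
  show "coinv_ideal m a n \<subseteq> carrier (mpol_ring n :: 'a mpol ring)" by (rule I.a_subset)
  show "0 \<in> (coinv_ideal m a n :: 'a mpol set)"
    using additive_subgroup.zero_closed[OF I.additive_subgroup_axioms] by (simp add: mpol_ring_simps(2))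
  show "p + q \<in> coinv_ideal m a n" if "p \<in> coinv_ideal m a n" "q \<in> coinv_ideal m a n"
    using additive_subgroup.a_closed[OF I.additive_subgroup_axioms that] by (simp add: mpol_ring_simps(4))
  show mult: "r * p \<in> coinv_ideal m a n"
    if "p \<in> coinv_ideal m a n" "r \<in> carrier (mpol_ring n)" for r p :: "'a mpol"
    using I.I_l_closed[OF that] by (simp add: mpol_ring_simps(5))
  show "p - q \<in> coinv_ideal m a n" if "p \<in> coinv_ideal m a n" "q \<in> coinv_ideal m a n"
  proof -
    have "- 1 \<in> carrier (mpol_ring n :: 'a mpol ring)"
      by (simp add: mpol_ring_simps(1))
    then show ?thesis
      using additive_subgroup.a_closed[OF I.additive_subgroup_axioms that(1) mult[OF that(2)]] by (fastforce simp add: mpol_ring_simps(4))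
  qed
qed

lemma coinvariants_simps:
  fixes p q :: "'a::comm_ring_1 mpol"
  shows "carrier (coinvariants m a n) = coinv_class m a n ` carrier (mpol_ring n :: 'a mpol ring)"
    and "\<zero>\<^bsub>coinvariants m a n\<^esub> = coinv_class m a n (0 :: 'a mpol)"
    and "p \<in> carrier (mpol_ring n) \<Longrightarrow> q \<in> carrier (mpol_ring n) \<Longrightarrow>
      coinv_class m a n p \<otimes>\<^bsub>coinvariants m a n\<^esub> coinv_class m a n q = coinv_class m a n (p * q)"
    and "p \<in> carrier (mpol_ring n) \<Longrightarrow> q \<in> carrier (mpol_ring n) \<Longrightarrow>
      coinv_class m a n p \<oplus>\<^bsub>coinvariants m a n\<^esub> coinv_class m a n q = coinv_class m a n (p + q)"
    and "p \<in> carrier (mpol_ring n) \<Longrightarrow> q \<in> carrier (mpol_ring n) \<Longrightarrow>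
      coinv_class m a n p = coinv_class m a n q \<longleftrightarrow> p - q \<in> coinv_ideal m a n"
proof -
  interpret I: ideal "coinv_ideal m a n" "mpol_ring n :: 'a mpol ring" by (rule ideal_coinv_ideal)
  interpret cring "mpol_ring n :: 'a mpol ring" by (rule cring_mpol_ring)
  interpret h: ring_hom_ring "mpol_ring n :: 'a mpol ring" "mpol_ring n Quot coinv_ideal m a n"
    "(+>\<^bsub>mpol_ring n\<^esub>) (coinv_ideal m a n)"
    by (rule I.rcos_ring_hom_ring)
  show "carrier (coinvariants m a n) = coinv_class m a n ` carrier (mpol_ring n :: 'a mpol ring)"
    unfolding coinvariants_def coinv_class_def FactRing_def A_RCOSETS_def' UNION_singleton_eq_range
    by simp
  show "\<zero>\<^bsub>coinvariants m a n\<^esub> = coinv_class m a n (0 :: 'a mpol)"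
    using h.hom_zero unfolding coinvariants_def coinv_class_def mpol_ring_simps(2) by (rule sym)
  assume pq: "p \<in> carrier (mpol_ring n)" "q \<in> carrier (mpol_ring n)"
  show "coinv_class m a n p \<otimes>\<^bsub>coinvariants m a n\<^esub> coinv_class m a n q = coinv_class m a n (p * q)"
    using h.hom_mult[OF pq] unfolding coinvariants_def coinv_class_def mpol_ring_simps(5) by (rule sym)
  show "coinv_class m a n p \<oplus>\<^bsub>coinvariants m a n\<^esub> coinv_class m a n q = coinv_class m a n (p + q)"
    using h.hom_add[OF pq] unfolding coinvariants_def coinv_class_def mpol_ring_simps(4) by (rule sym)
  show "coinv_class m a n p = coinv_class m a n q \<longleftrightarrow> p - q \<in> coinv_ideal m a n"
    using I.quotient_eq_iff_same_a_r_cos[OF I.ideal_axioms pq]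
    unfolding coinv_class_def mpol_minus(2)[OF pq] by (rule sym)
qed

lemma ring_coinvariants: "ring (coinvariants m a n :: 'a::comm_ring_1 mpol set ring)"
  unfolding coinvariants_def by (rule ideal.quotient_is_ring[OF ideal_coinv_ideal])

section \<open>Span and independence of classes of monomials\<close>

text \<open>Induction along the list: each line extension adds an arbitrary multiple of one more
  monomial class, and scalar times class is the class of \<open>single t c\<close>.\<close>

lemma Span_monomial_classes:
  assumes "\<And>t. t \<in> set ts \<Longrightarrow> keys t \<subseteq> {1..n}"
  shows "ring.Span (coinvariants m a n) (coinv_scalars m a n)
      (map (\<lambda>t. coinv_class m a n (single t (1::'a::comm_ring_1))) ts) =
    coinv_class m a n ` {p. keys p \<subseteq> set ts}"
  using assms
proof (induction ts)
  case Nil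
  interpret ring "coinvariants m a n :: 'a mpol set ring" by (rule ring_coinvariants)
  show ?case by (simp add: coinvariants_simps)
next
  case (Cons t ts)
  interpret ring "coinvariants m a n :: 'a mpol set ring" by (rule ring_coinvariants)
  let ?Q = "coinvariants m a n" and ?cl = "coinv_class m a n :: 'a mpol \<Rightarrow> _"
  have t: "single t c \<in> carrier (mpol_ring n)" for c :: 'a
    using Cons.prems[of t] by (simp add: mpol_ring_simps)
  have p: "p \<in> carrier (mpol_ring n)" if "keys p \<subseteq> set ts" for p :: "'a mpol"
    using that Cons.prems by (auto simp: mpol_ring_simps)
  have Const: "Const c \<in> carrier (mpol_ring n)" for c :: 'a
    by (simp add: mpol_ring_simps Const_def)
  have step: "(?cl (Const c) \<otimes>\<^bsub>?Q\<^esub> ?cl (single t 1)) \<oplus>\<^bsub>?Q\<^esub> ?cl p = ?cl (single t c + p)"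
    if "keys p \<subseteq> set ts" for c p
  proof -
    have "Const c * single t 1 = single t c"
      by (simp add: Const_def mult_single)
    then show ?thesis
      using t[of c] t[of 1] p[OF that] Const by (simp only: coinvariants_simps(3,4))
  qed
  have "Span (coinv_scalars m a n) (map (\<lambda>t. ?cl (single t 1)) (t # ts)) =
    line_extension (coinv_scalars m a n) (?cl (single t 1)) (?cl ` {p. keys p \<subseteq> set ts})"
    using Cons by simp
  also have "\<dots> = {?cl (single t c + p) | c p. keys p \<subseteq> set ts}"
    unfolding set_eq_iff line_extension_mem_iff coinv_scalars_def
    by (simp add: step Bex_def) (use step in metis)
  also have "\<dots> = ?cl ` {p. keys p \<subseteq> set (t # ts)}"
  proof (intro equalityI subsetI)
    fix y assume "y \<in> {?cl (single t c + p) | c p. keys p \<subseteq> set ts}"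
    then obtain c p where "y = ?cl (single t c + p)" "keys p \<subseteq> set ts" by blast
    then show "y \<in> ?cl ` {p. keys p \<subseteq> set (t # ts)}"
      using keys_add[of "single t c" p] by (auto split: if_splits)
  next
    fix y assume "y \<in> ?cl ` {p. keys p \<subseteq> set (t # ts)}"
    then obtain p where p: "y = ?cl p" "keys p \<subseteq> set (t # ts)" by blast
    \<comment> \<open>Splitting off the term at \<open>t\<close> leaves a polynomial supported on
      the tail of the list.\<close>
    have "keys (p - single t (lookup p t)) \<subseteq> set ts"
      using p(2) by (auto simp: in_keys_iff lookup_minus lookup_single when_def split: if_splits)
    moreover have "y = ?cl (single t (lookup p t) + (p - single t (lookup p t)))"
      using p(1) by simp
    ultimately show "y \<in> {?cl (single t c + p) | c p. keys p \<subseteq> set ts}" by blast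
  qed
  finally show ?case by simp
qed

text \<open>The list-based notion asks that no vector lie in the span of the later ones. Over a
  field this is the absence of nontrivial relations, because a relation can be scaled until the head
  has coefficient 1.\<close>

lemma independent_monomial_classes:
  assumes "distinct ts" "\<And>t. t \<in> set ts \<Longrightarrow> keys t \<subseteq> {1..n}"
  shows "ring.independent (coinvariants m a n) (coinv_scalars m a n)
      (map (\<lambda>t. coinv_class m a n (single t (1::'a::field))) ts) \<longleftrightarrow>
    (\<forall>p :: 'a mpol. keys p \<subseteq> set ts \<and> p \<in> coinv_ideal m a n \<longrightarrow> p = 0)"
  using assms
proof (induction ts)
  case Nil
  interpret ring "coinvariants m a n :: 'a mpol set ring" by (rule ring_coinvariants)
  show ?case by simp
next
  case (Cons t ts)
  interpret ring "coinvariants m a n :: 'a mpol set ring" by (rule ring_coinvariants)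
  let ?K = "coinv_scalars m a n :: 'a mpol set set" and ?cl = "coinv_class m a n :: 'a mpol \<Rightarrow> _"
  let ?I = "coinv_ideal m a n :: 'a mpol set"
  let ?v = "\<lambda>t. ?cl (single t 1)"
  have carrier: "p \<in> carrier (mpol_ring n)" if "keys p \<subseteq> set (t # ts)" for p :: "'a mpol"
    using that Cons.prems(2) by (auto simp: mpol_ring_simps)
  have vt: "?v t \<in> carrier (coinvariants m a n)"
    unfolding coinvariants_simps using carrier[of "single t 1"] by auto
  have "independent ?K (map ?v (t # ts)) \<longleftrightarrow>
      ?v t \<notin> Span ?K (map ?v ts) \<and> independent ?K (map ?v ts)"
    using vt by (auto intro: li_Cons elim: independent.cases)
  also have "?v t \<notin> Span ?K (map ?v ts) \<longleftrightarrow>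
      (\<forall>q. keys q \<subseteq> set ts \<longrightarrow> single t 1 - q \<notin> ?I)"
  proof -
    have "?v t = ?cl q \<longleftrightarrow> single t 1 - q \<in> ?I" if "keys q \<subseteq> set ts" for q
      using that by (intro coinvariants_simps(5) carrier) auto
    moreover have "Span ?K (map ?v ts) = ?cl ` {p. keys p \<subseteq> set ts}"
      using Cons.prems(2) by (intro Span_monomial_classes) simp
    ultimately show ?thesis by (simp only: image_iff) blast
  qed
  also have "independent ?K (map ?v ts) \<longleftrightarrow> (\<forall>p. keys p \<subseteq> set ts \<and> p \<in> ?I \<longrightarrow> p = 0)"
    using Cons by simp
  also have "(\<forall>q. keys q \<subseteq> set ts \<longrightarrow> single t 1 - q \<notin> ?I) \<and> (\<forall>p. keys p \<subseteq> set ts \<and> p \<in> ?I \<longrightarrow> p = 0) \<longleftrightarrow>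
    (\<forall>p. keys p \<subseteq> set (t # ts) \<and> p \<in> ?I \<longrightarrow> p = 0)" (is "?A \<and> ?B \<longleftrightarrow> ?C")
  proof (intro iffI conjI allI impI)
    fix p :: "'a mpol" assume AB: "?A \<and> ?B" and p: "keys p \<subseteq> set (t # ts) \<and> p \<in> ?I"
    show "p = 0"
    proof (cases "lookup p t = 0")
      case True
      with p have "keys p \<subseteq> set ts" by (auto simp: in_keys_iff)
      with AB p show ?thesis by blast
    next
      case False
      \<comment> \<open>After scaling, the \<open>t\<close>-terms of \<open>single t 1\<close> and
        of the relation cancel; the remainder is a \<open>q\<close> over the tail with
        \<open>single t 1 - q\<close> in the ideal, which \<open>?A\<close> forbids.\<close>
      let ?c = "inverse (lookup p t)"
      have q: "keys (single t 1 - Const ?c * p) \<subseteq> set ts"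
        using p False
        by (auto simp: in_keys_iff lookup_minus Const_def lookup_single_mult lookup_single when_def
            split: if_splits)
      have "Const ?c * p \<in> ?I"
        using p by (intro coinv_ideal_closed(5)) (auto simp: mpol_ring_simps Const_def)
      with AB q have False by fastforce
      then show ?thesis ..
    qed
  next
    fix q :: "'a mpol" assume C: "?C" and q: "keys q \<subseteq> set ts"
    show "single t 1 - q \<notin> ?I"
    proof
      assume "single t 1 - q \<in> ?I"
      moreover have "keys (single t 1 - q) \<subseteq> set (t # ts)"
        using q keys_diff[of "single t 1" q] by auto
      ultimately have "single t 1 = q" using C by (metis eq_iff_diff_eq_0)
      then have "t \<in> set ts" using q by auto
      then show False using Cons.prems(1) by simp
    qed
  qed auto
  finally show ?case .
qed

lemma keys_mono:
  fixes s t :: "nat \<Rightarrow>\<^sub>0 nat"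
  assumes "\<And>i. lookup s i \<le> lookup t i"
  shows "keys s \<subseteq> keys t"
proof
  fix i assume "i \<in> keys s"
  then show "i \<in> keys t" using assms[of i] by (simp add: in_keys_iff)
qed

lemma monomial_factors_single:
  assumes "keys \<alpha> \<subseteq> {1..n}"
  shows "monomial_factors n (single \<alpha> (1 :: 'a::comm_ring_1)) =
    (\<lambda>t. single t 1) ` {t. \<forall>i. lookup t i \<le> lookup \<alpha> i}"
proof (intro equalityI subsetI)
  fix g assume "g \<in> monomial_factors n (single \<alpha> (1 :: 'a))"
  then obtain t q where g: "g = single t 1" and "single \<alpha> (1::'a) = single t 1 * q"
    by (auto simp: monomial_factors_def monomials_def factor_def mpol_ring_simps)
  then have "lookup (single t 1 * q) \<alpha> = (1 :: 'a)" by (metis lookup_single_eq)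
  then have "\<forall>i. lookup t i \<le> lookup \<alpha> i"
    by (simp add: lookup_single_mult split: if_splits)
  with g show "g \<in> (\<lambda>t. single t 1) ` {t. \<forall>i. lookup t i \<le> lookup \<alpha> i}" by blast
next
  fix g :: "'a mpol" assume "g \<in> (\<lambda>t. single t 1) ` {t. \<forall>i. lookup t i \<le> lookup \<alpha> i}"
  then obtain t where t: "\<forall>i. lookup t i \<le> lookup \<alpha> i" and g: "g = single t 1" by blast
  have keys: "keys t \<subseteq> {1..n}" "keys (\<alpha> - t) \<subseteq> {1..n}"
    using t assms keys_mono[of t \<alpha>] keys_mono[of "\<alpha> - t" \<alpha>] by (auto simp: lookup_minus)
  have "t + (\<alpha> - t) = \<alpha>"
    using t by (intro poly_mapping_eqI) (simp add: lookup_add lookup_minus)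
  then have "single \<alpha> 1 = g * single (\<alpha> - t) 1"
    by (simp add: g mult_single)
  then have "g divides\<^bsub>mpol_ring n\<^esub> single \<alpha> 1"
    using keys(2) by (intro dividesI[of "single (\<alpha> - t) 1"]) (auto simp: mpol_ring_simps)
  with keys(1) show "g \<in> monomial_factors n (single \<alpha> 1)"
    by (auto simp: monomial_factors_def monomials_def g)
qed

lemma finite_exponents_below: "finite {t :: nat \<Rightarrow>\<^sub>0 nat. \<forall>i. lookup t i \<le> lookup \<alpha> i}"
proof (rule finite_imageD)
  let ?F = "\<lambda>t. restrict (lookup t) (keys \<alpha>)"
  show "finite (?F ` {t. \<forall>i. lookup t i \<le> lookup \<alpha> i})"
    by (rule finite_subset[of _ "PiE (keys \<alpha>) (\<lambda>i. {..lookup \<alpha> i})"]) (auto intro: finite_PiE)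
  show "inj_on ?F {t. \<forall>i. lookup t i \<le> lookup \<alpha> i}"
  proof (rule inj_onI, rule poly_mapping_eqI)
    fix s t i assume "s \<in> {t. \<forall>i. lookup t i \<le> lookup \<alpha> i}" "t \<in> {t. \<forall>i. lookup t i \<le> lookup \<alpha> i}"
      and "?F s = ?F t"
    then show "lookup s i = lookup t i"
      by (cases "i \<in> keys \<alpha>") (auto simp: restrict_def in_keys_iff dest!: spec[of _ i] fun_cong[of _ _ i])
  qed
qed

text \<open>Translates lists of cosets into exponents below \<alpha>: independence says that the
  ideal meets the polynomials supported there only in 0, spanning that every polynomial has a
  representative supported there. Both directions of the theorem work with this form.\<close>

lemma generates_block_basis_iff:
  fixes f :: "'a::field mpol"
  shows "generates_block_basis m a n f \<longleftrightarrow> (\<exists>\<alpha>. keys \<alpha> \<subseteq> {1..n} \<and> f = single \<alpha> 1 \<and>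
    (\<forall>p :: 'a mpol. (\<forall>t\<in>keys p. \<forall>i. lookup t i \<le> lookup \<alpha> i) \<and> p \<in> coinv_ideal m a n \<longrightarrow> p = 0) \<and>
    (\<forall>p\<in>carrier (mpol_ring n). \<exists>q. (\<forall>t\<in>keys q. \<forall>i. lookup t i \<le> lookup \<alpha> i) \<and>
      p - q \<in> (coinv_ideal m a n :: 'a mpol set)))" (is "_ \<longleftrightarrow> (\<exists>\<alpha>. _ \<and> _ \<and> ?ind \<alpha> \<and> ?span \<alpha>)")
proof -
  let ?cl = "coinv_class m a n :: 'a mpol \<Rightarrow> _"
  have inj: "inj (\<lambda>t :: nat \<Rightarrow>\<^sub>0 nat. single t (1::'a))"
    by (rule injI) (metis keys_single singleton_inject zero_neq_one)
  let ?D = "\<lambda>\<alpha>. {t. \<forall>i. lookup t i \<le> lookup \<alpha> i}"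
  have main: "ring.independent (coinvariants m a n) (coinv_scalars m a n) (map ?cl gs) \<and>
      ring.Span (coinvariants m a n) (coinv_scalars m a n) (map ?cl gs) = carrier (coinvariants m a n)
      \<longleftrightarrow> ?ind \<alpha> \<and> ?span \<alpha>"
    if \<alpha>: "keys \<alpha> \<subseteq> {1..n}" and ts: "distinct ts" "set ts = ?D \<alpha>" and gs: "gs = map (\<lambda>t. single t 1) ts"
    for \<alpha> ts gs
  proof -
    have keys: "keys t \<subseteq> {1..n}" if "t \<in> set ts" for t
      using that \<alpha> keys_mono[of t \<alpha>] unfolding ts(2) by blast
    have map: "map ?cl gs = map (\<lambda>t. ?cl (single t 1)) ts"
      by (simp add: gs)
    have carrier: "q \<in> carrier (mpol_ring n)" if "keys q \<subseteq> set ts" for q :: "'a mpol"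
      using that keys by (auto simp: mpol_ring_simps)
    have "?cl ` {p. keys p \<subseteq> set ts} = ?cl ` carrier (mpol_ring n) \<longleftrightarrow>
        (\<forall>p\<in>carrier (mpol_ring n). \<exists>q. keys q \<subseteq> set ts \<and> ?cl p = ?cl q)"
    proof -
      have "?cl ` {p. keys p \<subseteq> set ts} \<subseteq> ?cl ` carrier (mpol_ring n)"
        using carrier by (intro image_mono) auto
      then have "?cl ` {p. keys p \<subseteq> set ts} = ?cl ` carrier (mpol_ring n) \<longleftrightarrow>
          ?cl ` carrier (mpol_ring n) \<subseteq> ?cl ` {p. keys p \<subseteq> set ts}"
        by (simp only: set_eq_subset simp_thms)
      then show ?thesis
        by (simp only: image_subset_iff image_iff Bex_def mem_Collect_eq)
    qed
    also have "\<dots> \<longleftrightarrow> ?span \<alpha>"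
    proof (intro ball_cong ex_cong1 refl)
      fix p q :: "'a mpol" assume p: "p \<in> carrier (mpol_ring n)"
      show "keys q \<subseteq> set ts \<and> ?cl p = ?cl q \<longleftrightarrow>
          (\<forall>t\<in>keys q. \<forall>i. lookup t i \<le> lookup \<alpha> i) \<and> p - q \<in> coinv_ideal m a n"
        unfolding subset_iff[of "keys q"] Ball_def ts(2) mem_Collect_eq
        using coinvariants_simps(5)[OF p carrier[of q], of m a]
        by (auto simp only: subset_iff ts(2) mem_Collect_eq)
    qed
    also have "?cl ` {p. keys p \<subseteq> set ts} =
        ring.Span (coinvariants m a n) (coinv_scalars m a n) (map ?cl gs)"
      unfolding map by (rule Span_monomial_classes[symmetric]) (rule keys)
    finally have span: "ring.Span (coinvariants m a n) (coinv_scalars m a n) (map ?cl gs) =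
        ?cl ` carrier (mpol_ring n) \<longleftrightarrow> ?span \<alpha>" .
    have "ring.independent (coinvariants m a n) (coinv_scalars m a n) (map ?cl gs) \<longleftrightarrow>
        (\<forall>p :: 'a mpol. keys p \<subseteq> set ts \<and> p \<in> coinv_ideal m a n \<longrightarrow> p = 0)"
      unfolding map by (rule independent_monomial_classes[OF ts(1)]) (rule keys)
    also have "\<dots> \<longleftrightarrow> ?ind \<alpha>"
      unfolding ts(2) subset_eq mem_Collect_eq by (rule refl)
    finally show ?thesis
      using span unfolding coinvariants_simps(1) by blast
  qed
  show ?thesis
  proof
    assume "generates_block_basis m a n f"
    then obtain \<alpha> gs where \<alpha>: "keys \<alpha> \<subseteq> {1..n}" "f = single \<alpha> 1"
      and gs: "distinct gs" "set gs = monomial_factors n f"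
      and *: "ring.independent (coinvariants m a n) (coinv_scalars m a n) (map ?cl gs)"
      "ring.Span (coinvariants m a n) (coinv_scalars m a n) (map ?cl gs) = carrier (coinvariants m a n)"
      by (auto simp: generates_block_basis_def monomials_def)
    \<comment> \<open>Recovers the exponent of a monic monomial, so that the enumeration
      \<open>gs\<close> of monomials becomes one of exponents.\<close>
    let ?un = "the_inv (\<lambda>t. single t (1::'a))"
    have set_gs: "set gs = (\<lambda>t. single t 1) ` ?D \<alpha>"
      using gs(2) \<alpha> by (simp add: monomial_factors_single)
    have "gs = map (\<lambda>t. single t 1) (map ?un gs)"
    proof -
      have "single (?un g) 1 = g" if "g \<in> set gs" for g
        using that the_inv_f_f[OF inj] unfolding set_gs by auto
      then show ?thesis by (simp add: map_idI)
    qed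
    moreover have "distinct (map ?un gs)"
    proof -
      have "inj_on ?un (set gs)"
        unfolding set_gs by (rule inj_onI) (auto simp: the_inv_f_f[OF inj])
      with gs(1) show ?thesis by (simp add: distinct_map)
    qed
    moreover have "set (map ?un gs) = ?D \<alpha>"
      unfolding set_map set_gs image_image the_inv_f_f[OF inj] by simp
    ultimately show "\<exists>\<alpha>. keys \<alpha> \<subseteq> {1..n} \<and> f = single \<alpha> 1 \<and> ?ind \<alpha> \<and> ?span \<alpha>"
      using main[OF \<alpha>(1)] * \<alpha> by blast
  next
    assume "\<exists>\<alpha>. keys \<alpha> \<subseteq> {1..n} \<and> f = single \<alpha> 1 \<and> ?ind \<alpha> \<and> ?span \<alpha>"
    then obtain \<alpha> where \<alpha>: "keys \<alpha> \<subseteq> {1..n}" "f = single \<alpha> 1" "?ind \<alpha> \<and> ?span \<alpha>" by blast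
    obtain ts where ts: "set ts = ?D \<alpha>" "distinct ts"
      using finite_distinct_list[OF finite_exponents_below] by blast
    let ?gs = "map (\<lambda>t. single t (1::'a)) ts"
    have "distinct ?gs"
      using ts(2) inj by (simp add: distinct_map inj_on_def)
    moreover have "set ?gs = monomial_factors n f"
      using ts(1) \<alpha> by (simp add: monomial_factors_single)
    ultimately show "generates_block_basis m a n f"
      using main[OF \<alpha>(1) ts(2,1) refl] \<alpha>
      by (auto simp: generates_block_basis_def monomials_def intro!: exI[of _ ?gs])
  qed
qed

section \<open>Exponents of invariants\<close>

text \<open>The multiplicative group of a finite field is cyclic. If \<open>b\<close> generates it
  and its order is \<open>m * l\<close>, then \<open>b ^ l\<close> has order exactly
  \<open>m\<close>.\<close>

lemma exists_primitive_root_of_unity: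
  assumes "m > 0" "m dvd card (UNIV :: 'a::{field,finite} set) - 1"
  shows "\<exists>\<zeta> :: 'a. \<forall>k. \<zeta> ^ k = 1 \<longleftrightarrow> m dvd k"
proof -
  \<comment> \<open>The field type is repackaged as a record so that the theorem on generators of
    the multiplicative group applies.\<close>
  define R :: "'a ring" where
    "R = \<lparr>carrier = UNIV, monoid.mult = (*), one = 1, zero = 0, add = (+)\<rparr>"
  have R [simp]: "carrier R = UNIV" "\<zero>\<^bsub>R\<^esub> = 0" "\<one>\<^bsub>R\<^esub> = 1" "x \<otimes>\<^bsub>R\<^esub> y = x * y" "x \<oplus>\<^bsub>R\<^esub> y = x + y" for x y
    by (simp_all add: R_def)
  interpret field R
  proof (rule cring.cring_fieldI2)
    show "cring R"
    proof (rule cringI)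
      show "abelian_group R"
        by (rule abelian_groupI) (auto simp: ac_simps intro: exI[of _ "- x" for x])
      show "comm_monoid R"
        by (rule comm_monoidI) (auto simp: ac_simps)
    qed (simp add: distrib_right)
    show "\<exists>b\<in>carrier R. x \<otimes>\<^bsub>R\<^esub> b = \<one>\<^bsub>R\<^esub>" if "x \<in> carrier R" "x \<noteq> \<zero>\<^bsub>R\<^esub>" for x
      using that by (auto intro: exI[of _ "inverse x"])
  qed simp
  interpret G: group "mult_of R" by (rule field_mult_group)
  have pow: "x [^]\<^bsub>mult_of R\<^esub> k = x ^ k" for x and k :: nat
    unfolding nat_pow_mult_of by (induction k) (simp_all add: mult.commute)
  obtain b where b: "b \<in> carrier (mult_of R)" "carrier (mult_of R) = {b [^]\<^bsub>mult_of R\<^esub> i | i::nat. i \<in> UNIV}"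
    using finite_field_mult_group_has_gen by (auto simp: nat_pow_mult_of)
  let ?N = "card (UNIV :: 'a set) - 1"
  have order: "order (mult_of R) = ?N"
    by (simp add: order_mult_of order_def)
  have fin: "finite (carrier (mult_of R))" by simp
  \<comment> \<open>Every element is a power of \<open>b\<close>, and the powers with exponent below
    the order of \<open>b\<close> already exhaust them, so the order of \<open>b\<close> is at least
    the group order.\<close>
  have "card (carrier (mult_of R)) = card ((\<lambda>i. b [^]\<^bsub>mult_of R\<^esub> i) ` {0..G.ord b - 1})"
    using G.ord_elems[OF fin b(1)] b(2) by (intro arg_cong[where f = card]) auto
  also have "\<dots> \<le> G.ord b"
    using card_image_le[of "{0..G.ord b - 1}"] G.ord_ge_1[OF fin b(1)] by fastforce
  finally have "?N \<le> G.ord b"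
    using order by (simp only: order_def)
  moreover have "G.ord b dvd ?N"
    using G.ord_dvd_group_order[OF b(1)] order by simp
  moreover have "?N > 0"
    using card_mono[of UNIV "{0, 1 :: 'a}"] by simp
  ultimately have "G.ord b = ?N"
    by (auto dest: dvd_imp_le)
  then have b_pow: "b ^ k = 1 \<longleftrightarrow> ?N dvd k" for k
    using G.pow_eq_id[OF b(1), of k] by (simp add: pow)
  obtain l where l: "?N = m * l" using assms(2) by blast
  with \<open>?N > 0\<close> have "l > 0" by (cases l) auto
  have "(b ^ l) ^ k = 1 \<longleftrightarrow> m dvd k" for k
    using \<open>l > 0\<close> b_pow[of "l * k"] unfolding l power_mult mult.commute[of m l] by simp
  then show ?thesis by blast
qed

lemma invariant_lookup_permute:
  fixes p :: "'a::comm_ring_1 mpol"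
  assumes "p \<in> invariants n (imprim_group m a n)" "\<sigma> permutes {1..n}"
  shows "lookup p (Poly_Mapping.map_key \<sigma> t) = lookup p t"
proof -
  have "(\<Prod>i\<in>{1..n}. 1 ^ lookup t (\<sigma> i)) * lookup p (Poly_Mapping.map_key \<sigma> t) = lookup p t"
    using assms unfolding invariants_imprim_group_iff by (elim conjE allE[of _ \<sigma>] allE[of _ "\<lambda>_. 1"]) simp
  then show ?thesis by simp
qed

lemma invariant_lookup_diag:
  fixes p :: "'a::field mpol" and w :: "nat \<Rightarrow> 'a"
  assumes "p \<in> invariants n (imprim_group m a n)" "t \<in> keys p"
    and "\<And>j. j \<in> {1..n} \<Longrightarrow> w j ^ m = 1" "(\<Prod>j\<in>{1..n}. w j) ^ (m div a) = 1"
  shows "(\<Prod>i\<in>{1..n}. w i ^ lookup t i) = 1"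
proof -
  have "(\<Prod>i\<in>{1..n}. w i ^ lookup t (id i)) * lookup p (Poly_Mapping.map_key id t) = lookup p t"
    using assms permutes_id unfolding invariants_imprim_group_iff by blast
  moreover have "Poly_Mapping.map_key id t = t"
    using map_key_id[of t] by (simp add: id_def)
  ultimately show ?thesis
    using assms(2) by (simp add: in_keys_iff)
qed

text \<open>Tested on the diagonal matrix with the single nontrivial entry
  \<open>\<zeta> ^ a\<close> at place \<open>i\<close>. Its power \<open>m div a\<close> is
  \<open>\<zeta> ^ m = 1\<close>, so it belongs to the group, and invariance forces
  \<open>m dvd a * lookup t i\<close>.\<close>

lemma invariant_exponent_dvd:
  fixes p :: "'a::field mpol"
  assumes \<zeta>: "\<And>k. \<zeta> ^ k = (1::'a) \<longleftrightarrow> m dvd k" and "a dvd m" "m > 0"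
    and p: "p \<in> invariants n (imprim_group m a n)" "t \<in> keys p" and i: "i \<in> {1..n}"
  shows "m div a dvd lookup t i"
proof -
  let ?w = "\<lambda>j. if j = i then \<zeta> ^ a else 1"
  have "(\<Prod>j\<in>{1..n}. ?w j ^ lookup t j) = 1"
  proof (rule invariant_lookup_diag[OF p])
    show "?w j ^ m = 1" for j
      using \<zeta>[of "a * m"] by (simp add: power_mult)
    show "(\<Prod>j\<in>{1..n}. ?w j) ^ (m div a) = 1"
      using i \<zeta>[of m] \<open>a dvd m\<close> by (simp flip: power_mult)
  qed
  also have "(\<Prod>j\<in>{1..n}. ?w j ^ lookup t j) = (\<Prod>j\<in>{1..n}. if j = i then (\<zeta> ^ a) ^ lookup t i else 1)"
    by (intro prod.cong) auto
  also have "\<dots> = \<zeta> ^ (a * lookup t i)"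
    using i by (simp add: power_mult)
  finally have "m dvd a * lookup t i" by (simp add: \<zeta>)
  then have "a * (m div a) dvd a * lookup t i" using \<open>a dvd m\<close> by simp
  then show ?thesis using \<open>m > 0\<close> \<open>a dvd m\<close> by (auto simp: dvd_mult_cancel1)
qed

text \<open>Tested on the diagonal matrix with \<zeta> at \<open>i\<close> and its inverse
  \<open>\<zeta> ^ (m - 1)\<close> at \<open>j\<close>: the determinant is 1, so it lies in the
  group for every \<open>a\<close>. The entry at \<open>j\<close> is invisible to \<open>t\<close>,
  which leaves \<open>\<zeta> ^ lookup t i = 1\<close>.\<close>

lemma invariant_exponent_dvd_zero:
  fixes p :: "'a::field mpol"
  assumes \<zeta>: "\<And>k. \<zeta> ^ k = (1::'a) \<longleftrightarrow> m dvd k" and "m > 0"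
    and p: "p \<in> invariants n (imprim_group m a n)" "t \<in> keys p"
    and ij: "i \<in> {1..n}" "j \<in> {1..n}" "i \<noteq> j" and "lookup t j = 0"
  shows "m dvd lookup t i"
proof -
  let ?w = "\<lambda>k. if k = i then \<zeta> else if k = j then \<zeta> ^ (m - 1) else 1"
  have *: "(\<Prod>k\<in>{1..n}. f k) = f i * f j" if "\<And>k. k \<noteq> i \<Longrightarrow> k \<noteq> j \<Longrightarrow> f k = 1" for f :: "nat \<Rightarrow> 'a"
  proof -
    have "(\<Prod>k\<in>{1..n}. f k) = prod f {i, j}"
      using ij that by (intro prod.mono_neutral_right) auto
    then show ?thesis using ij by simp
  qed
  have "(\<Prod>k\<in>{1..n}. ?w k ^ lookup t k) = 1"
  proof (rule invariant_lookup_diag[OF p])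
    show "?w k ^ m = 1" for k
      using \<zeta>[of m] \<zeta>[of "(m - 1) * m"] by (simp add: power_mult)
    have "(\<Prod>k\<in>{1..n}. ?w k) = \<zeta> ^ Suc (m - 1)"
      using ij by (subst *) auto
    then show "(\<Prod>k\<in>{1..n}. ?w k) ^ (m div a) = 1"
      using \<zeta>[of m] \<open>m > 0\<close> by simp
  qed
  moreover have "(\<Prod>k\<in>{1..n}. ?w k ^ lookup t k) = \<zeta> ^ lookup t i"
    using ij \<open>lookup t j = 0\<close> by (subst *) auto
  ultimately show ?thesis by (simp add: \<zeta>)
qed

lemma mono_degree_eq:
  assumes "keys t \<subseteq> {1..n}"
  shows "mono_degree t = (\<Sum>i\<in>{1..n}. lookup t i)"
  unfolding mono_degree_def using assms by (intro sum.mono_neutral_left) (auto simp: in_keys_iff)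

section \<open>Complete homogeneous polynomials in the powers of the variables\<close>

text \<open>Exponents of the monomials of degree \<open>r\<close> in \<open>y_1, ..., y_k\<close>,
  where \<open>y_i = x_i^m\<close>. The number \<open>k\<close> of variables is independent of the
  ambient \<open>n\<close>, so truncations to fewer variables are elements of the same ring.\<close>

definition hexps :: "nat \<Rightarrow> nat \<Rightarrow> nat \<Rightarrow> (nat \<Rightarrow>\<^sub>0 nat) set" where
  "hexps m k r = {t. keys t \<subseteq> {1..k} \<and> (\<forall>i. m dvd lookup t i) \<and> (\<Sum>i\<in>{1..k}. lookup t i) = m * r}"

definition hsym :: "nat \<Rightarrow> nat \<Rightarrow> nat \<Rightarrow> 'a::comm_ring_1 mpol" where
  "hsym m k r = (\<Sum>t\<in>hexps m k r. single t 1)"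

text \<open>Connects the exponents used in the proofs with the tuples by which the product relations
  are indexed.\<close>

lemma bij_betw_tuples_hexps:
  assumes "m > 0"
  shows "bij_betw (\<lambda>j. \<Sum>i\<in>{1..k}. single i (m * j i)) (tuples k r) (hexps m k r)"
proof (rule bij_betwI[where g = "\<lambda>t. \<lambda>i\<in>{1..k}. lookup t i div m"])
  show "(\<lambda>j. \<Sum>i\<in>{1..k}. single i (m * j i)) \<in> tuples k r \<rightarrow> hexps m k r"
    by (auto simp: hexps_def tuples_def sum_single_index in_keys_iff sum_distrib_left[symmetric]
        split: if_splits)
  show "(\<lambda>t. \<lambda>i\<in>{1..k}. lookup t i div m) \<in> hexps m k r \<rightarrow> tuples k r"
  proof
    fix t assume t: "t \<in> hexps m k r"
    then have "m * (\<Sum>i\<in>{1..k}. lookup t i div m) = (\<Sum>i\<in>{1..k}. lookup t i)"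
      unfolding sum_distrib_left by (intro sum.cong) (auto simp: hexps_def)
    with t assms show "(\<lambda>i\<in>{1..k}. lookup t i div m) \<in> tuples k r"
      by (simp add: tuples_def hexps_def)
  qed
  show "(\<lambda>i\<in>{1..k}. lookup (\<Sum>i\<in>{1..k}. single i (m * j i)) i div m) = j" if "j \<in> tuples k r" for j
    using that assms by (auto simp: tuples_def sum_single_index fun_eq_iff PiE_def extensional_def)
  show "(\<Sum>i\<in>{1..k}. single i (m * (\<lambda>i\<in>{1..k}. lookup t i div m) i)) = t" if "t \<in> hexps m k r" for t
    using that by (intro poly_mapping_eqI) (auto simp: hexps_def sum_single_index in_keys_iff)
qed

lemma finite_hexps: "m > 0 \<Longrightarrow> finite (hexps m k r)"
  using bij_betw_finite[OF bij_betw_tuples_hexps] finite_tuples by blast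

lemma lookup_hsym: "m > 0 \<Longrightarrow> lookup (hsym m k r) t = (if t \<in> hexps m k r then 1 else 0)"
  using finite_hexps[of m k r] by (simp add: hsym_def lookup_sum lookup_single when_def)

lemma keys_hsym: "m > 0 \<Longrightarrow> keys (hsym m k r :: 'a::comm_ring_1 mpol) = hexps m k r"
  by (auto simp: in_keys_iff lookup_hsym split: if_splits)

lemma hsym_eq_sum_tuples:
  assumes "m > 0"
  shows "hsym m k r = (\<Sum>j\<in>tuples k r. \<Prod>i\<in>{1..k}. X i ^ (m * j i))"
  unfolding hsym_def X_power prod_single
  by (simp add: sum.reindex_bij_betw[OF bij_betw_tuples_hexps[OF assms], symmetric])

lemma single_le_iff: "(\<forall>i. lookup (single k c) i \<le> lookup t i) \<longleftrightarrow> (c::nat) \<le> lookup t k"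
  by (auto simp: lookup_single when_def)

text \<open>The monomials are sorted by whether \<open>y_(k+1)\<close> divides them. Those that it
  divides are \<open>y_(k+1)\<close> times a monomial of degree \<open>r\<close>; in the others the
  exponent of \<open>x_(k+1)\<close> is a multiple of \<open>m\<close> below \<open>m\<close>, hence
  0.\<close>

lemma hsym_Suc_Suc:
  assumes "m > 0"
  shows "hsym m (Suc k) (Suc r) =
    hsym m k (Suc r) + single (single (Suc k) m) 1 * (hsym m (Suc k) r :: 'a::comm_ring_1 mpol)"
proof (rule poly_mapping_eqI)
  fix t
  show "lookup (hsym m (Suc k) (Suc r)) t =
    lookup (hsym m k (Suc r) + single (single (Suc k) m) 1 * (hsym m (Suc k) r :: 'a mpol)) t"
  proof (cases "m \<le> lookup t (Suc k)")
    case True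
    have keys: "keys (t - single (Suc k) m) \<subseteq> {1..Suc k} \<longleftrightarrow> keys t \<subseteq> {1..Suc k}"
      by (auto simp: subset_iff in_keys_iff lookup_minus lookup_single when_def split: if_splits)
        (metis One_nat_def Suc_le_mono le_refl zero_le)+
    have dvd: "m dvd lookup (t - single (Suc k) m) i \<longleftrightarrow> m dvd lookup t i" for i
      using True by (auto simp: lookup_minus lookup_single when_def dvd_minus_self)
    have "(\<Sum>i\<in>{1..k}. lookup (t - single (Suc k) m) i) = (\<Sum>i\<in>{1..k}. lookup t i)"
      by (intro sum.cong) (auto simp: lookup_minus lookup_single when_def)
    then have "t - single (Suc k) m \<in> hexps m (Suc k) r \<longleftrightarrow> t \<in> hexps m (Suc k) (Suc r)"
      using True unfolding hexps_def mem_Collect_eq keys dvd by (auto simp: lookup_minus)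
    moreover have "t \<notin> hexps m k (Suc r)"
      using True assms by (auto simp: hexps_def in_keys_iff subset_iff dest!: spec[of _ "Suc k"])
    ultimately show ?thesis
      using True assms by (simp add: lookup_add lookup_hsym lookup_single_mult single_le_iff)
  next
    case False
    have "t \<in> hexps m (Suc k) (Suc r) \<longleftrightarrow> t \<in> hexps m k (Suc r)"
    proof (cases "lookup t (Suc k) = 0")
      case True
      then have "keys t \<subseteq> {1..Suc k} \<longleftrightarrow> keys t \<subseteq> {1..k}"
        by (auto simp: atLeastAtMostSuc_conv in_keys_iff)
      with True show ?thesis by (simp add: hexps_def)
    next
      case nz: False
      then have "\<not> m dvd lookup t (Suc k)"
        using \<open>\<not> m \<le> lookup t (Suc k)\<close> by (auto dest: dvd_imp_le)
      then show ?thesis by (auto simp: hexps_def)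
    qed
    with False assms show ?thesis
      by (simp add: lookup_add lookup_hsym lookup_single_mult single_le_iff)
  qed
qed

text \<open>The conditions defining \<open>hexps m n r\<close> are symmetric in the variables, and
  \<open>m\<close>-th roots of unity disappear on exponents divisible by \<open>m\<close>; this
  holds for every \<open>a\<close>.\<close>

lemma hsym_invariant:
  assumes "m > 0"
  shows "(hsym m n r :: 'a::comm_ring_1 mpol) \<in> invariants n (imprim_group m a n)"
  unfolding invariants_imprim_group_iff
proof (intro conjI allI impI)
  show "(hsym m n r :: 'a mpol) \<in> carrier (mpol_ring n)"
    using assms by (auto simp: mpol_ring_simps keys_hsym hexps_def)
  fix \<sigma> and t :: "nat \<Rightarrow>\<^sub>0 nat" and w :: "nat \<Rightarrow> 'a"
  assume \<sigma>: "\<sigma> permutes {1..n}" and w: "\<forall>j\<in>{1..n}. w j ^ m = 1"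
  have inj: "inj \<sigma>" using \<sigma> by (rule permutes_inj)
  have lookup: "lookup (Poly_Mapping.map_key \<sigma> t) i = lookup t (\<sigma> i)" for i
    by (rule lookup_map_key[OF inj])
  have "keys (Poly_Mapping.map_key \<sigma> t) \<subseteq> {1..n} \<longleftrightarrow> keys t \<subseteq> {1..n}"
    unfolding keys_map_key[OF inj] vimage_subset_eq[OF permutes_bij[OF \<sigma>]] permutes_image[OF \<sigma>] ..
  moreover have "(\<forall>i. m dvd lookup t (\<sigma> i)) \<longleftrightarrow> (\<forall>i. m dvd lookup t i)"
    by (metis permutes_surj[OF \<sigma>] surjD)
  moreover have "(\<Sum>i\<in>{1..n}. lookup t (\<sigma> i)) = (\<Sum>i\<in>{1..n}. lookup t i)"
    using sum.permute[OF \<sigma>, of "lookup t"] by (simp add: o_def)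
  ultimately have "Poly_Mapping.map_key \<sigma> t \<in> hexps m n r \<longleftrightarrow> t \<in> hexps m n r"
    by (simp add: hexps_def lookup)
  moreover have "(\<Prod>i\<in>{1..n}. w i ^ lookup t (\<sigma> i)) = 1" if "t \<in> hexps m n r"
  proof (rule prod.neutral, rule ballI)
    fix i assume "i \<in> {1..n}"
    moreover have "m dvd lookup t (\<sigma> i)"
      using that by (simp add: hexps_def)
    then obtain l where "lookup t (\<sigma> i) = m * l" ..
    ultimately show "w i ^ lookup t (\<sigma> i) = 1"
      using w by (simp add: power_mult)
  qed
  ultimately show "(\<Prod>i\<in>{1..n}. w i ^ lookup t (\<sigma> i)) * lookup (hsym m n r) (Poly_Mapping.map_key \<sigma> t) =
      lookup (hsym m n r) t"
    using assms by (simp add: lookup_hsym)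
qed

text \<open>Downward induction on \<open>k\<close>. For \<open>k = n\<close> the polynomial is an
  invariant of positive degree; the step solves \<open>hsym_Suc_Suc\<close> for the polynomial in
  fewer variables, and \<open>n < r + k\<close> is just what keeps both other terms in
  range.\<close>

lemma hsym_in_coinv_ideal:
  assumes "m > 0" "k \<le> n" "n < r + k"
  shows "(hsym m k r :: 'a::comm_ring_1 mpol) \<in> coinv_ideal m a n"
  using assms(2,3)
proof (induction k arbitrary: r rule: inc_induct)
  case base
  have "homogeneous (m * r) (hsym m n r :: 'a mpol)"
    using assms(1) mono_degree_eq by (auto simp: homogeneous_def keys_hsym hexps_def)
  with base assms(1) show ?case
    by (intro invariant_in_coinv_ideal[OF hsym_invariant]) auto
next
  case (step k)
  then obtain s where r: "r = Suc s" by (cases r) auto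
  have "(hsym m (Suc k) r :: 'a mpol) \<in> coinv_ideal m a n" "(hsym m (Suc k) s :: 'a mpol) \<in> coinv_ideal m a n"
    using step by (auto simp: r)
  moreover have "single (single (Suc k) m) (1::'a) \<in> carrier (mpol_ring n)"
    using step by (simp add: mpol_ring_simps)
  moreover have "(hsym m k r :: 'a mpol) = hsym m (Suc k) r - single (single (Suc k) m) 1 * hsym m (Suc k) s"
    using hsym_Suc_Suc[OF assms(1), of k s, where ?'a = 'a] by (simp add: r)
  ultimately show ?case
    by (metis coinv_ideal_closed(4,5))
qed

section \<open>The block basis for $a = 1$\<close>

text \<open>For \<open>\<sigma> = id\<close> this is the exponent of the generator of the block basis.\<close>

definition staircase :: "nat \<Rightarrow> nat \<Rightarrow> (nat \<Rightarrow> nat) \<Rightarrow> nat \<Rightarrow>\<^sub>0 nat" where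
  "staircase m n \<sigma> = (\<Sum>i\<in>{1..n}. single i (m * (n + 1 - \<sigma> i) - 1))"

lemma lookup_staircase:
  "lookup (staircase m n \<sigma>) i = (if i \<in> {1..n} then m * (n + 1 - \<sigma> i) - 1 else 0)"
  by (simp add: staircase_def sum_single_index)

text \<open>Among monomials of fixed degree in the first \<open>k\<close> variables, the weight is
  largest when the whole degree sits on \<open>x_k\<close>. This makes the rewriting of
  \<open>x_k^(m r)\<close> terminate.\<close>

lemma hexps_weight_less:
  assumes "u \<in> hexps m k r" "u \<noteq> single k (m * r)" "k \<le> n" "k \<ge> 1"
  shows "(\<Sum>i\<in>{1..n}. i * lookup u i) < k * (m * r)"
proof -
  have "(\<Sum>i\<in>{1..n}. i * lookup u i) = (\<Sum>i\<in>{1..k}. i * lookup u i)"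
    using assms(1,3) by (intro sum.mono_neutral_right) (auto simp: hexps_def in_keys_iff)
  also have "\<dots> < (\<Sum>i\<in>{1..k}. k * lookup u i)"
  proof (rule sum_strict_mono_ex1)
    show "\<forall>i\<in>{1..k}. i * lookup u i \<le> k * lookup u i" by simp
    show "\<exists>i\<in>{1..k}. i * lookup u i < k * lookup u i"
    proof (rule ccontr)
      assume "\<not> ?thesis"
      then have zero: "lookup u i = 0" if "i \<in> {1..k}" "i \<noteq> k" for i
        using that by fastforce
      have "(\<Sum>i\<in>{1..k}. lookup u i) = (\<Sum>i\<in>{k}. lookup u i)"
        using zero assms(4) by (intro sum.mono_neutral_right) auto
      then have "lookup u k = m * r"
        using assms(1) by (simp add: hexps_def)
      moreover have "lookup u i = 0" if "i \<noteq> k" for i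
        using zero[of i] that assms(1) by (cases "i \<in> {1..k}") (auto simp: hexps_def in_keys_iff)
      ultimately have "u = single k (m * r)"
        by (intro poly_mapping_eqI) (auto simp: lookup_single when_def)
      with assms(2) show False by contradiction
    qed
  qed simp
  also have "\<dots> = k * (m * r)"
    using assms(1) by (simp add: hexps_def flip: sum_distrib_left)
  finally show ?thesis .
qed

text \<open>Induction on the weight \<open>\<Sum>i. i * t i\<close>, which the relation \<open>hsym m k (n + 1 - k)\<close> decreases.\<close>

lemma block_monomials_span:
  fixes p :: "'a::comm_ring_1 mpol"
  assumes "m > 0" "p \<in> carrier (mpol_ring n)"
  shows "\<exists>q. (\<forall>t\<in>keys q. \<forall>i. lookup t i \<le> lookup (staircase m n id) i) \<and> p - q \<in> coinv_ideal m a n"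
proof -
  define D where "D = {t. \<forall>i. lookup t i \<le> lookup (staircase m n id) i}"
  \<comment> \<open>Polynomials congruent to one supported on block exponents. \<open>B\<close> is
    closed under sums, so single terms suffice.\<close>
  define B where "B = {p :: 'a mpol. \<exists>q. keys q \<subseteq> D \<and> p - q \<in> coinv_ideal m a n}"
  have B_ideal: "p \<in> B" if "p \<in> coinv_ideal m a n" for p
    using that by (auto simp: B_def intro!: exI[of _ 0])
  have B_diff: "p - p' \<in> B" if p: "p \<in> B" "p' \<in> B" for p p'
  proof -
    from p obtain q q' where q: "keys q \<subseteq> D" "p - q \<in> coinv_ideal m a n"
      "keys q' \<subseteq> D" "p' - q' \<in> coinv_ideal m a n" by (auto simp: B_def)
    have "(p - q) - (p' - q') \<in> coinv_ideal m a n"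
      by (rule coinv_ideal_closed) (use q in auto)
    moreover have "(p - q) - (p' - q') = (p - p') - (q - q')" by simp
    moreover have "keys (q - q') \<subseteq> D"
      using q keys_diff[of q q'] by blast
    ultimately show ?thesis unfolding B_def by force
  qed
  have B_sum: "sum f A \<in> B" if "\<And>x. x \<in> A \<Longrightarrow> f x \<in> B" for f and A :: "(nat \<Rightarrow>\<^sub>0 nat) set"
    using that
  proof (induction A rule: infinite_finite_induct)
    case (insert x A)
    then have "f x - (0 - sum f A) \<in> B"
      using B_ideal[OF coinv_ideal_closed(2)] by (intro B_diff) auto
    with insert show ?case by simp
  qed (auto intro: B_ideal coinv_ideal_closed(2))
  have "single t c \<in> B" if "keys t \<subseteq> {1..n}" for t and c :: 'a
    using that
  proof (induction "\<Sum>i\<in>{1..n}. i * lookup t i" arbitrary: t rule: less_induct)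
    case less
    show ?case
    proof (cases "t \<in> D")
      case True
      then show ?thesis
        by (auto simp: B_def coinv_ideal_closed(2) intro!: exI[of _ "single t c"] split: if_splits)
    next
      case False
      then obtain k where "lookup t k > lookup (staircase m n id) k"
        by (auto simp: D_def not_le)
      then have k: "k \<in> {1..n}" "lookup t k > m * (n + 1 - k) - 1"
        using less.prems by (auto simp: lookup_staircase in_keys_iff subset_iff split: if_splits)
      \<comment> \<open>The least \<open>r\<close> for which \<open>hsym m k r\<close> is known to
        lie in the ideal; \<open>x_k^(m r)\<close> divides the monomial because its exponent at
        \<open>k\<close> exceeds \<open>m * r - 1\<close>.\<close>
      define r where "r = n + 1 - k"
      define u0 s where "u0 = single k (m * r)" and "s = t - u0"
      have "m * r \<le> lookup t k" using k(2) \<open>m > 0\<close> by (simp add: r_def)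
      then have t: "t = s + u0"
        by (intro poly_mapping_eqI) (auto simp: s_def u0_def lookup_add lookup_minus lookup_single when_def)
      have keys_s: "keys s \<subseteq> {1..n}"
        using less.prems keys_mono[of s t] by (auto simp: s_def lookup_minus)
      have u0: "u0 \<in> hexps m k r"
        using k(1) by (auto simp: hexps_def u0_def lookup_single when_def)
      have in_ideal: "single s c * hsym m k r \<in> coinv_ideal m a n"
        using k(1) keys_s \<open>m > 0\<close>
        by (intro coinv_ideal_closed(5) hsym_in_coinv_ideal) (auto simp: r_def mpol_ring_simps)
      \<comment> \<open>The summand at \<open>u0\<close> is the given term; all others have smaller
        weight, so the relation solved for this term is the reduction step.\<close>
      have "single s c * hsym m k r = (\<Sum>u\<in>hexps m k r. single (s + u) c)"
        by (simp add: hsym_def sum_distrib_left mult_single)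
      also have "\<dots> = single t c + (\<Sum>u\<in>hexps m k r - {u0}. single (s + u) c)"
        using u0 finite_hexps[OF \<open>m > 0\<close>] by (subst sum.remove[of _ u0]) (auto simp: t)
      finally have eq: "single t c = single s c * hsym m k r - (\<Sum>u\<in>hexps m k r - {u0}. single (s + u) c)"
        by simp
      have "single (s + u) c \<in> B" if u: "u \<in> hexps m k r - {u0}" for u
      proof (rule less.hyps)
        have "(\<Sum>i\<in>{1..n}. i * lookup u i) < k * (m * r)"
          using u k(1) by (intro hexps_weight_less) (auto simp: u0_def)
        also have "\<dots> = (\<Sum>i\<in>{1..n}. i * lookup u0 i)"
          using k(1) by (simp add: u0_def lookup_single when_def if_distrib cong: if_cong)
        finally show "(\<Sum>i\<in>{1..n}. i * lookup (s + u) i) < (\<Sum>i\<in>{1..n}. i * lookup t i)"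
          by (simp add: t lookup_add distrib_left sum.distrib)
        have "keys u \<subseteq> {1..n}"
          using u k(1) by (auto simp: hexps_def)
        then show "keys (s + u) \<subseteq> {1..n}"
          using keys_s Poly_Mapping.keys_add[of s u] by blast
      qed
      then have "(\<Sum>u\<in>hexps m k r - {u0}. single (s + u) c) \<in> B"
        by (rule B_sum)
      with in_ideal show ?thesis
        unfolding eq by (intro B_diff[OF B_ideal])
    qed
  qed
  then have "(\<Sum>t\<in>keys p. single t (lookup p t)) \<in> B"
    using assms(2) by (intro B_sum) (auto simp: mpol_ring_simps)
  then show ?thesis
    by (auto simp: sum_single_lookup B_def D_def subset_iff Ball_def)
qed

section \<open>The alternating functional and independence\<close>

text \<open>Since \<open>m * (n + 1 - \<sigma> i) - 1 = m * (n - \<sigma> i) + (m - 1)\<close> for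
  \<open>\<sigma> i \<le> n\<close> and positive \<open>m\<close>, this pairs the coefficients of
  \<open>p\<close> with those of the Vandermonde determinant in the \<open>x_i^m\<close> times
  \<open>(x_1 ... x_n)^(m-1)\<close>.\<close>

definition alt_coeff :: "nat \<Rightarrow> nat \<Rightarrow> 'a::comm_ring_1 mpol \<Rightarrow> 'a" where
  "alt_coeff m n p = (\<Sum>\<sigma> | \<sigma> permutes {1..n}. of_int (sign \<sigma>) * lookup p (staircase m n \<sigma>))"

lemma alt_coeff_add: "alt_coeff m n (p + q) = alt_coeff m n p + alt_coeff m n q"
  by (simp add: alt_coeff_def lookup_add distrib_left sum.distrib)

lemma alt_coeff_sum: "alt_coeff m n (sum f A) = (\<Sum>x\<in>A. alt_coeff m n (f x))"
proof (induction A rule: infinite_finite_induct)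
  case (insert x A)
  then show ?case by (simp add: alt_coeff_add)
qed (simp_all add: alt_coeff_def)

text \<open>Dividing by \<open>m\<close> turns the \<open>u i + 1\<close> into \<open>n\<close>
  distinct positive integers, whose sum is at least \<open>1 + ... + n\<close>.\<close>

lemma inj_on_exponents_sum_ge:
  fixes u :: "nat \<Rightarrow> nat"
  assumes "inj_on u {1..n}" "\<And>i. i \<in> {1..n} \<Longrightarrow> m dvd u i + 1"
  shows "m * \<Sum>{1..n} \<le> (\<Sum>i\<in>{1..n}. u i + 1)"
proof -
  define \<gamma> where "\<gamma> i = (u i + 1) div m" for i
  have \<gamma>: "u i + 1 = m * \<gamma> i" "\<gamma> i = Suc (\<gamma> i - 1)" if "i \<in> {1..n}" for i
  proof -
    show "u i + 1 = m * \<gamma> i" using assms(2)[OF that] by (simp add: \<gamma>_def)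
    then show "\<gamma> i = Suc (\<gamma> i - 1)" by (cases "\<gamma> i") auto
  qed
  \<comment> \<open>The shift by one gives distinct naturals starting from 0, the form in which the
    bound on their sum is available.\<close>
  have "inj_on (\<lambda>i. \<gamma> i - 1) {1..n}"
  proof (rule inj_onI)
    fix i j assume ij: "i \<in> {1..n}" "j \<in> {1..n}" "\<gamma> i - 1 = \<gamma> j - 1"
    then have "u i + 1 = u j + 1" using \<gamma> by metis
    with ij assms(1) show "i = j" by (auto dest: inj_onD)
  qed
  then have "\<Sum>{0..<n} \<le> (\<Sum>i\<in>{1..n}. \<gamma> i - 1)"
    using card_sum_le_nat_sum[of "(\<lambda>i. \<gamma> i - 1) ` {1..n}"] by (simp add: card_image sum.reindex)
  moreover have "\<Sum>{1..n} = \<Sum>{0..<n} + n"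
    by (induction n) auto
  moreover have "(\<Sum>i\<in>{1..n}. \<gamma> i) = (\<Sum>i\<in>{1..n}. (\<gamma> i - 1) + 1)"
    using \<gamma>(2) by (intro sum.cong) auto
  ultimately have "\<Sum>{1..n} \<le> (\<Sum>i\<in>{1..n}. \<gamma> i)"
    by (simp only: sum.distrib sum_constant card_atLeastAtMost) simp
  moreover have "(\<Sum>i\<in>{1..n}. u i + 1) = m * (\<Sum>i\<in>{1..n}. \<gamma> i)"
    unfolding sum_distrib_left using \<gamma>(1) by (intro sum.cong) auto
  ultimately show ?thesis by simp
qed

lemma permuted_range_less: "\<sigma> permutes {1..n} \<Longrightarrow> i \<in> {1..n} \<Longrightarrow> \<sigma> i \<le> n"
  using permutes_in_image[of \<sigma> "{1..n}" i] by simp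

text \<open>
  If some summand is nonzero, all \<open>u i + 1\<close> are positive multiples of \<open>m\<close> with total less than
  \<open>m + 2m + \<dots> + nm\<close>, so two exponents of \<open>u\<close> agree; swapping them is a sign-reversing involution.
\<close>

lemma alt_coeff_invariant_multiple:
  fixes g :: "'a::field mpol"
  assumes \<zeta>: "\<And>k. \<zeta> ^ k = (1::'a) \<longleftrightarrow> m dvd k" and "m > 0"
    and g: "g \<in> invariants n (imprim_group m 1 n)" "homogeneous d g" "d > 0"
  shows "alt_coeff m n (single u c * g) = 0"
proof (cases "\<forall>\<sigma>. \<sigma> permutes {1..n} \<longrightarrow> lookup (single u c * g) (staircase m n \<sigma>) = 0")
  case True
  then show ?thesis by (simp add: alt_coeff_def)
next
  case False
  then obtain \<rho> where \<rho>: "\<rho> permutes {1..n}" "lookup (single u c * g) (staircase m n \<rho>) \<noteq> 0" by blast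
  define v where "v = staircase m n \<rho> - u"
  have u_le: "lookup u i \<le> lookup (staircase m n \<rho>) i" for i
    using \<rho>(2) by (auto simp: lookup_single_mult split: if_splits)
  have v: "v \<in> keys g"
    using \<rho>(2) by (auto simp: lookup_single_mult v_def in_keys_iff split: if_splits)
  \<comment> \<open>The \<open>+ 1\<close> undoes the \<open>- 1\<close> in the staircase, so the
    total at each place is a multiple of \<open>m\<close>; as that multiple is positive, no
    truncation occurs.\<close>
  have sum_uv: "lookup v i + (lookup u i + 1) = m * (n + 1 - \<rho> i)" if "i \<in> {1..n}" for i
  proof -
    have "m * (n + 1 - \<rho> i) > 0"
      using permuted_range_less[OF \<rho>(1) that] \<open>m > 0\<close> by simp
    with u_le[of i] that show ?thesis
      by (simp add: v_def lookup_minus lookup_staircase del: nat_0_less_mult_iff)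
  qed
  have "m dvd lookup u i + 1" if "i \<in> {1..n}" for i
  proof -
    have "m dvd lookup v i"
      using invariant_exponent_dvd[OF \<zeta> _ \<open>m > 0\<close> g(1) v that] by simp
    then show ?thesis
      using sum_uv[OF that] by (metis dvd_add_right_iff dvd_triv_left)
  qed
  \<comment> \<open>The exponents of \<open>v\<close> sum to \<open>d > 0\<close>, so those of
    \<open>u\<close> fall short of the staircase total.\<close>
  moreover have "\<not> m * \<Sum>{1..n} \<le> (\<Sum>i\<in>{1..n}. lookup u i + 1)"
  proof -
    have "keys v \<subseteq> {1..n}"
      using v g(1) by (auto simp: invariants_def mpol_ring_simps)
    then have "(\<Sum>i\<in>{1..n}. lookup v i) = d"
      using v g(2) mono_degree_eq by (auto simp: homogeneous_def)
    then have "d + (\<Sum>i\<in>{1..n}. lookup u i + 1) = (\<Sum>i\<in>{1..n}. lookup v i + (lookup u i + 1))"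
      by (simp only: sum.distrib)
    also have "\<dots> = (\<Sum>i\<in>{1..n}. m * (n + 1 - \<rho> i))"
      using sum_uv by (intro sum.cong) auto
    also have "\<dots> = (\<Sum>i\<in>{1..n}. m * (n + 1 - i))"
      using sum.permute[OF \<rho>(1), of "\<lambda>i. m * (n + 1 - i)"] by (simp add: o_def)
    also have "\<dots> = (\<Sum>i\<in>{1..n}. m * i)"
      by (rule sum.reindex_bij_witness[of _ "\<lambda>i. n + 1 - i" "\<lambda>i. n + 1 - i"]) auto
    also have "\<dots> = m * \<Sum>{1..n}"
      by (simp add: sum_distrib_left)
    finally show ?thesis using \<open>d > 0\<close> by linarith
  qed
  ultimately have "\<not> inj_on (lookup u) {1..n}"
    using inj_on_exponents_sum_ge by blast
  then obtain i j where ij: "i \<in> {1..n}" "j \<in> {1..n}" "i \<noteq> j" "lookup u i = lookup u j"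
    by (auto simp: inj_on_def)
  let ?\<tau> = "transpose i j"
  have \<tau>: "?\<tau> permutes {1..n}" using ij by (intro permutes_swap_id)
  have u: "lookup u (?\<tau> k) = lookup u k" for k
    using ij(4) by (simp add: transpose_def)
  \<comment> \<open>\<open>u\<close> is fixed by the swap and \<open>g\<close> is symmetric, so the
    coefficient is unchanged while the sign of the permutation flips.\<close>
  have inv: "lookup (single u c * g) (staircase m n (\<sigma> \<circ> ?\<tau>)) = lookup (single u c * g) (staircase m n \<sigma>)" for \<sigma>
  proof -
    have st: "lookup (staircase m n (\<sigma> \<circ> ?\<tau>)) k = lookup (staircase m n \<sigma>) (?\<tau> k)" for k
      using permutes_in_image[OF \<tau>, of k] by (simp add: lookup_staircase)
    have "(\<forall>k. lookup u k \<le> lookup (staircase m n \<sigma>) (?\<tau> k)) \<longleftrightarrow> (\<forall>k. lookup u k \<le> lookup (staircase m n \<sigma>) k)"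
      by (metis u transpose_involutory)
    moreover have "staircase m n (\<sigma> \<circ> ?\<tau>) - u = Poly_Mapping.map_key ?\<tau> (staircase m n \<sigma> - u)"
      by (intro poly_mapping_eqI) (simp add: lookup_map_key lookup_minus st u)
    ultimately show ?thesis
      by (simp add: lookup_single_mult st invariant_lookup_permute[OF g(1) \<tau>])
  qed
  \<comment> \<open>Distinct permutations are cancelled in pairs; showing that the sum equals its
    own negative would not be enough in characteristic 2.\<close>
  show ?thesis
    unfolding alt_coeff_def
  proof (rule sum_involution_eq_0[where h = "\<lambda>\<sigma>. \<sigma> \<circ> ?\<tau>"])
    fix \<sigma> assume "\<sigma> \<in> {\<sigma>. \<sigma> permutes {1..n}}"
    then have \<sigma>: "\<sigma> permutes {1..n}" by simp
    then have "permutation \<sigma>" "permutation ?\<tau>"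
      using permutes_imp_permutation[of "{1..n}"] \<tau> by auto
    then have "sign (\<sigma> \<circ> ?\<tau>) = - sign \<sigma>"
      using ij(3) by (simp add: sign_compose sign_swap_id)
    then show "of_int (sign (\<sigma> \<circ> ?\<tau>)) * lookup (single u c * g) (staircase m n (\<sigma> \<circ> ?\<tau>)) +
        of_int (sign \<sigma>) * lookup (single u c * g) (staircase m n \<sigma>) = 0"
      by (simp add: inv)
    show "\<sigma> \<circ> ?\<tau> \<in> {\<sigma>. \<sigma> permutes {1..n}}"
      using permutes_compose[OF \<tau> \<sigma>] by simp
    show "\<sigma> \<circ> ?\<tau> \<circ> ?\<tau> = \<sigma>"
      by (simp add: comp_assoc)
    show "\<sigma> \<circ> ?\<tau> \<noteq> \<sigma>"
    proof
      assume "\<sigma> \<circ> ?\<tau> = \<sigma>"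
      then have "\<sigma> j = \<sigma> i" by (metis comp_apply transpose_apply_first)
      then show False using ij(3) permutes_inj[OF \<sigma>] by (auto dest: injD)
    qed
  qed
qed

text \<open>The vanishing is required for all monomial multiples at once, which makes it stable
  under multiplication by any polynomial: expand the multiplier into terms.\<close>

lemma alt_coeff_coinv_ideal:
  fixes p :: "'a::field mpol"
  assumes \<zeta>: "\<And>k. \<zeta> ^ k = (1::'a) \<longleftrightarrow> m dvd k" and "m > 0"
    and p: "p \<in> coinv_ideal m 1 n"
  shows "alt_coeff m n (single u c * p) = 0"
proof -
  define J where "J = {p \<in> carrier (mpol_ring n :: 'a mpol ring). \<forall>u c. alt_coeff m n (single u c * p) = 0}"
  interpret cring "mpol_ring n :: 'a mpol ring" by (rule cring_mpol_ring)
  have "ideal J (mpol_ring n)"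
  proof (rule ideal_mpol_ringI)
    show "0 \<in> J" using zero_closed by (simp add: J_def mpol_ring_simps alt_coeff_def)
    show "p + q \<in> J" if "p \<in> J" "q \<in> J" for p q
      using that a_closed[of p q] by (simp add: J_def mpol_ring_simps(4) distrib_left alt_coeff_add)
    show "r * p \<in> J" if p: "p \<in> J" and r: "r \<in> carrier (mpol_ring n)" for p r
    proof -
      have "single u c * (r * p) = (\<Sum>t\<in>keys r. single (u + t) (c * lookup r t) * p)" for u c
      proof -
        have "single u c * (r * p) = single u c * ((\<Sum>t\<in>keys r. single t (lookup r t)) * p)"
          by (simp add: sum_single_lookup)
        then show ?thesis
          by (simp add: sum_distrib_left sum_distrib_right mult_single flip: mult.assoc)
      qed
      then show ?thesis
        using p m_closed[OF r, of p] by (simp add: J_def alt_coeff_sum mpol_ring_simps(5))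
    qed
  qed (auto simp: J_def)
  then have "coinv_ideal m 1 n \<subseteq> J"
  proof (rule coinv_ideal_minimal)
    fix g :: "'a mpol" and d assume "g \<in> invariants n (imprim_group m 1 n)" "d > 0" "homogeneous d g"
    then show "g \<in> J"
      using alt_coeff_invariant_multiple[OF \<zeta> \<open>m > 0\<close>] by (auto simp: J_def invariants_def)
  qed
  with p show ?thesis by (auto simp: J_def)
qed

text \<open>Expand the sum of the squares of \<open>i - \<sigma> i\<close>, which is positive, and
  use that \<sigma> permutes the squares. The integers avoid truncated differences.\<close>

lemma sum_mult_permutes_less:
  fixes \<sigma> :: "nat \<Rightarrow> nat"
  assumes "\<sigma> permutes {1..n}" "\<sigma> \<noteq> id"
  shows "(\<Sum>i\<in>{1..n}. i * \<sigma> i) < (\<Sum>i\<in>{1..n}. i * i)"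
proof -
  have "\<exists>i\<in>{1..n}. \<sigma> i \<noteq> i"
    using assms permutes_not_in[OF assms(1)] by (metis eq_id_iff)
  then obtain k where "k \<in> {1..n}" "\<sigma> k \<noteq> k" by blast
  then have "0 < (\<Sum>i\<in>{1..n}. (int i - int (\<sigma> i))\<^sup>2)"
    by (intro sum_pos2[of _ k]) auto
  also have "\<dots> = (\<Sum>i\<in>{1..n}. int (i * i)) + (\<Sum>i\<in>{1..n}. int (\<sigma> i * \<sigma> i)) - 2 * (\<Sum>i\<in>{1..n}. int (i * \<sigma> i))"
    unfolding sum_distrib_left sum.distrib[symmetric] sum_subtractf[symmetric]
    by (intro sum.cong) (auto simp: power2_eq_square algebra_simps)
  also have "(\<Sum>i\<in>{1..n}. int (\<sigma> i * \<sigma> i)) = (\<Sum>i\<in>{1..n}. int (i * i))"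
    using sum.permute[OF assms(1), of "\<lambda>i. int (i * i)"] by (simp add: o_def)
  finally have "(\<Sum>i\<in>{1..n}. int (i * \<sigma> i)) < (\<Sum>i\<in>{1..n}. int (i * i))" by simp
  then show ?thesis by (simp only: of_nat_sum[symmetric] of_nat_less_iff)
qed

text \<open>Weight of the staircase plus \<open>m\<close> times the sum of
  \<open>i * \<rho> i\<close> does not depend on \<rho>, so the rearrangement inequality reverses
  into a minimum at the identity.\<close>

lemma staircase_weight_less:
  assumes "m > 0" "\<sigma> permutes {1..n}" "\<sigma> \<noteq> id"
  shows "(\<Sum>i\<in>{1..n}. i * lookup (staircase m n id) i) < (\<Sum>i\<in>{1..n}. i * lookup (staircase m n \<sigma>) i)"
proof -
  have *: "(\<Sum>i\<in>{1..n}. i * lookup (staircase m n \<rho>) i) + m * (\<Sum>i\<in>{1..n}. i * \<rho> i) =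
      (\<Sum>i\<in>{1..n}. i * (m * (n + 1) - 1))" if \<rho>: "\<rho> permutes {1..n}" for \<rho>
    unfolding sum_distrib_left sum.distrib[symmetric]
  proof (intro sum.cong refl)
    fix i assume i: "i \<in> {1..n}"
    have "m * (n + 1 - \<rho> i) > 0"
      using permuted_range_less[OF \<rho> i] \<open>m > 0\<close> by simp
    moreover have "m * (n + 1) = m * (n + 1 - \<rho> i) + m * \<rho> i"
      using permuted_range_less[OF \<rho> i] by (simp flip: distrib_left)
    ultimately have "m * (n + 1) - 1 = (m * (n + 1 - \<rho> i) - 1) + m * \<rho> i"
      by linarith
    then show "i * lookup (staircase m n \<rho>) i + m * (i * \<rho> i) = i * (m * (n + 1) - 1)"
      using i by (simp only: lookup_staircase if_True distrib_left mult.left_commute)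
  qed
  have "m * (\<Sum>i\<in>{1..n}. i * \<sigma> i) < m * (\<Sum>i\<in>{1..n}. i * id i)"
    using sum_mult_permutes_less[OF assms(2,3)] \<open>m > 0\<close> by simp
  with *[OF assms(2)] *[OF permutes_id] show ?thesis by linarith
qed

text \<open>Take a term \<alpha> of \<open>p\<close> of maximal weight and multiply by its
  complement in the generator. In the alternating sum only the identity survives, and it contributes
  the coefficient at \<alpha>, which therefore vanishes.\<close>

lemma block_monomials_independent:
  fixes p :: "'a::field mpol"
  assumes \<zeta>: "\<And>k. \<zeta> ^ k = (1::'a) \<longleftrightarrow> m dvd k" and "m > 0"
    and p: "p \<in> coinv_ideal m 1 n" "\<And>t i. t \<in> keys p \<Longrightarrow> lookup t i \<le> lookup (staircase m n id) i"
  shows "p = 0"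
proof (rule ccontr)
  let ?W = "\<lambda>t. \<Sum>i\<in>{1..n}. i * lookup t i" and ?E = "staircase m n"
  assume "p \<noteq> 0"
  then have "keys p \<noteq> {}" by simp
  then have "Max (?W ` keys p) \<in> ?W ` keys p" by (intro Max_in) auto
  then obtain \<alpha> where \<alpha>: "\<alpha> \<in> keys p" "Max (?W ` keys p) = ?W \<alpha>" by blast
  have max: "?W t \<le> ?W \<alpha>" if "t \<in> keys p" for t
    using that unfolding \<alpha>(2)[symmetric] by (intro Max_ge) auto
  define u where "u = ?E id - \<alpha>"
  have u: "lookup u i + lookup \<alpha> i = lookup (?E id) i" for i
    using p(2)[OF \<alpha>(1)] by (simp add: u_def lookup_minus)
  \<comment> \<open>a permuted staircase exceeds \<open>?E id\<close> in weight, hence would meet \<open>p\<close> above the maximal weight\<close>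
  have zero: "of_int (sign \<sigma>) * lookup (single u 1 * p) (?E \<sigma>) = 0"
    if \<sigma>: "\<sigma> permutes {1..n}" "\<sigma> \<noteq> id" for \<sigma>
  proof (cases "(\<forall>i. lookup u i \<le> lookup (?E \<sigma>) i) \<and> ?E \<sigma> - u \<in> keys p")
    case True
    then have "lookup (?E \<sigma> - u) i + lookup (?E id) i = lookup (?E \<sigma>) i + lookup \<alpha> i" for i
      using u[of i] by (simp add: lookup_minus)
    then have "?W (?E \<sigma> - u) + ?W (?E id) = ?W (?E \<sigma>) + ?W \<alpha>"
      by (simp flip: sum.distrib distrib_left)
    with max[of "?E \<sigma> - u"] True staircase_weight_less[OF \<open>m > 0\<close> \<sigma>] have False by linarith
    then show ?thesis ..
  qed (auto simp: lookup_single_mult in_keys_iff)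
  have "alt_coeff m n (single u 1 * p) = lookup (single u 1 * p) (?E id)"
    unfolding alt_coeff_def using permutes_id
    by (subst sum.remove[of _ id]) (auto simp: finite_permutations intro!: sum.neutral zero)
  also have "\<dots> = lookup p \<alpha>"
  proof -
    have "?E id - u = \<alpha>"
      using u by (intro poly_mapping_eqI) (simp add: lookup_minus flip: u)
    moreover have "\<forall>i. lookup u i \<le> lookup (?E id) i"
      by (simp add: u_def lookup_minus)
    ultimately show ?thesis by (simp add: lookup_single_mult)
  qed
  finally show False
    using alt_coeff_coinv_ideal[OF \<zeta> \<open>m > 0\<close> p(1)] \<alpha>(1) by (simp add: in_keys_iff)
qed

section \<open>No block basis for $a > 1$\<close>

text \<open>Multiplication never lowers degrees, so invariants decide. If some exponent of a term is
  0, a nonzero one is a multiple of \<open>m\<close>, and \<open>m > m div a\<close>. Otherwise all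
  \<open>n > 1\<close> exponents are at least \<open>m div a\<close>.\<close>

lemma coinv_ideal_degree_gt:
  fixes p :: "'a::field mpol"
  assumes \<zeta>: "\<And>k. \<zeta> ^ k = (1::'a) \<longleftrightarrow> m dvd k" and "m > 0" "a dvd m" "a > 1" "n > 1"
    and p: "p \<in> coinv_ideal m a n" "t \<in> keys p"
  shows "m div a < mono_degree t"
proof -
  define J where "J = {p \<in> carrier (mpol_ring n :: 'a mpol ring). \<forall>t\<in>keys p. m div a < mono_degree t}"
  interpret cring "mpol_ring n :: 'a mpol ring" by (rule cring_mpol_ring)
  have "m div a > 0"
    using assms dvd_imp_le[of a m] by (simp add: div_greater_zero_iff)
  have "m div a < m" using assms by simp
  have "ideal J (mpol_ring n)"
  proof (rule ideal_mpol_ringI)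
    show "0 \<in> J" using zero_closed by (simp add: J_def mpol_ring_simps)
    show "p + q \<in> J" if "p \<in> J" "q \<in> J" for p q
      using that a_closed[of p q] Poly_Mapping.keys_add[of p q]
      by (auto simp: J_def mpol_ring_simps(4))
    show "r * p \<in> J" if p: "p \<in> J" and r: "r \<in> carrier (mpol_ring n)" for p r
    proof -
      have "m div a < mono_degree t" if t: "t \<in> keys (r * p)" for t
      proof -
        from t keys_mult[of r p] obtain u v where uv: "t = u + v" "u \<in> keys r" "v \<in> keys p" by blast
        with p r have "keys u \<subseteq> {1..n}" "keys v \<subseteq> {1..n}"
          by (auto simp: J_def mpol_ring_simps(1))
        moreover from this have "keys (u + v) \<subseteq> {1..n}"
          using Poly_Mapping.keys_add[of u v] by blast
        ultimately have "mono_degree t = mono_degree u + mono_degree v"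
          by (simp add: uv(1) mono_degree_eq[of _ n] lookup_add sum.distrib)
        moreover have "m div a < mono_degree v"
          using p uv(3) by (auto simp: J_def)
        ultimately show ?thesis by simp
      qed
      then show ?thesis
        using p m_closed[OF r, of p] by (simp add: J_def mpol_ring_simps(5))
    qed
  qed (auto simp: J_def)
  then have "coinv_ideal m a n \<subseteq> J"
  proof (rule coinv_ideal_minimal)
    fix g :: "'a mpol" and d
    assume g: "g \<in> invariants n (imprim_group m a n)" "d > 0" "homogeneous d g"
    then have carrier: "g \<in> carrier (mpol_ring n)" by (simp add: invariants_def)
    have "m div a < mono_degree t" if t: "t \<in> keys g" for t
    proof -
      have deg: "mono_degree t = (\<Sum>i\<in>{1..n}. lookup t i)"
        using carrier t by (intro mono_degree_eq) (simp add: mpol_ring_simps)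
      have "mono_degree t > 0"
        using g t by (simp add: homogeneous_def)
      show ?thesis
      proof (cases "\<exists>j\<in>{1..n}. lookup t j = 0")
        case True
        then obtain j where j: "j \<in> {1..n}" "lookup t j = 0" by blast
        obtain i where i: "i \<in> {1..n}" "lookup t i > 0"
          using \<open>mono_degree t > 0\<close> unfolding deg by (metis gr0I less_irrefl sum.neutral)
        with j have "m dvd lookup t i"
          by (intro invariant_exponent_dvd_zero[OF \<zeta> \<open>m > 0\<close> g(1) t]) auto
        with i(2) have "m \<le> lookup t i" by (auto dest: dvd_imp_le)
        also have "\<dots> \<le> mono_degree t"
          unfolding deg using i(1) by (intro member_le_sum) auto
        finally show ?thesis using \<open>m div a < m\<close> by linarith
      next
        case False
        then have "m div a \<le> lookup t i" if "i \<in> {1..n}" for i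
          using invariant_exponent_dvd[OF \<zeta> \<open>a dvd m\<close> \<open>m > 0\<close> g(1) t that] that by (auto dest: dvd_imp_le)
        then have "(\<Sum>i\<in>{1..n}. m div a) \<le> mono_degree t"
          unfolding deg by (rule sum_mono)
        then have "n * (m div a) \<le> mono_degree t" by simp
        moreover have "1 * (m div a) < n * (m div a)"
          using \<open>m div a > 0\<close> \<open>n > 1\<close> by (intro mult_strict_right_mono)
        ultimately show ?thesis by linarith
      qed
    qed
    with carrier show "g \<in> J" by (simp add: J_def)
  qed
  with p show ?thesis by (auto simp: J_def)
qed

text \<open>A diagonal matrix scales this monomial by the power \<open>m div a\<close> of its
  determinant, which is 1 by the definition of the group.\<close>

lemma variables_product_in_coinv_ideal:
  assumes "m div a > 0" "n > 0"
  shows "single (\<Sum>i\<in>{1..n}. single i (m div a)) (1 :: 'a::comm_ring_1) \<in> coinv_ideal m a n"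
proof -
  define e where "e = (\<Sum>i\<in>{1..n}. single i (m div a))"
  have e: "lookup e i = (if i \<in> {1..n} then m div a else 0)" for i
    unfolding e_def by (rule sum_single_index) simp
  have keys: "keys e \<subseteq> {1..n}"
    by (auto simp: in_keys_iff e split: if_splits)
  have "single e (1::'a) \<in> invariants n (imprim_group m a n)"
    unfolding invariants_imprim_group_iff
  proof (intro conjI allI impI)
    show "single e (1::'a) \<in> carrier (mpol_ring n)"
      using keys by (simp add: mpol_ring_simps)
    fix \<sigma> t and w :: "nat \<Rightarrow> 'a"
    assume \<sigma>: "\<sigma> permutes {1..n}" and w: "(\<Prod>j\<in>{1..n}. w j) ^ (m div a) = 1"
    have "lookup e (\<sigma> i) = lookup e i" for i
      using permutes_in_image[OF \<sigma>, of i] by (simp add: e)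
    then have "e = Poly_Mapping.map_key \<sigma> t \<longleftrightarrow> e = t"
      by (auto simp: poly_mapping_eq_iff fun_eq_iff lookup_map_key[OF permutes_inj[OF \<sigma>]])
        (metis permutes_surj[OF \<sigma>] surjD)
    moreover have "(\<Prod>i\<in>{1..n}. w i ^ lookup e (\<sigma> i)) = 1"
      using w \<open>\<And>i. lookup e (\<sigma> i) = lookup e i\<close> by (simp add: e prod_power_distrib)
    ultimately show "(\<Prod>i\<in>{1..n}. w i ^ lookup t (\<sigma> i)) * lookup (single e 1) (Poly_Mapping.map_key \<sigma> t) =
        lookup (single e 1) t"
      by (auto simp: lookup_single when_def)
  qed
  moreover have "homogeneous (n * (m div a)) (single e (1::'a))"
    by (simp add: homogeneous_def mono_degree_eq[OF keys] e)
  ultimately show ?thesis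
    unfolding e_def[symmetric] using assms by (intro invariant_in_coinv_ideal[of _ _ _ _ "n * (m div a)"]) auto
qed

lemma no_block_basis:
  fixes f :: "'a::field mpol"
  assumes \<zeta>: "\<And>k. \<zeta> ^ k = (1::'a) \<longleftrightarrow> m dvd k" and "m > 0" "a dvd m" "a > 1" "n > 1"
  shows "\<not> generates_block_basis m a n f"
proof
  assume "generates_block_basis m a n f"
  then obtain \<alpha> where \<alpha>: "keys \<alpha> \<subseteq> {1..n}"
    and ind: "\<And>p :: 'a mpol. \<forall>t\<in>keys p. \<forall>i. lookup t i \<le> lookup \<alpha> i \<Longrightarrow> p \<in> coinv_ideal m a n \<Longrightarrow> p = 0"
    and span: "\<And>p :: 'a mpol. p \<in> carrier (mpol_ring n) \<Longrightarrow>
      \<exists>q. (\<forall>t\<in>keys q. \<forall>i. lookup t i \<le> lookup \<alpha> i) \<and> p - q \<in> coinv_ideal m a n"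
    unfolding generates_block_basis_iff by blast
  define e where "e = (\<Sum>i\<in>{1..n}. single i (m div a))"
  have e: "lookup e i = (if i \<in> {1..n} then m div a else 0)" for i
    unfolding e_def by (rule sum_single_index) simp
  have "m div a > 0"
    using assms dvd_imp_le[of a m] by (simp add: div_greater_zero_iff)
  \<comment> \<open>Otherwise the product of all variables to the power \<open>m div a\<close>
    divides the generator, which then is a block monomial inside the ideal.\<close>
  have "\<exists>i\<in>{1..n}. lookup \<alpha> i < m div a"
  proof (rule ccontr)
    assume "\<not> ?thesis"
    then have "\<alpha> = (\<alpha> - e) + e"
      by (intro poly_mapping_eqI) (auto simp: lookup_add lookup_minus e not_less)
    then have "single \<alpha> (1::'a) = single (\<alpha> - e) 1 * single e 1"
      by (simp add: mult_single)
    moreover have "single (\<alpha> - e) (1::'a) \<in> carrier (mpol_ring n)"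
      using \<alpha> keys_mono[of "\<alpha> - e" \<alpha>] by (auto simp: mpol_ring_simps lookup_minus)
    ultimately have "single \<alpha> (1::'a) \<in> coinv_ideal m a n"
      using coinv_ideal_closed(5)[OF variables_product_in_coinv_ideal[of m a n, folded e_def]] \<open>m div a > 0\<close> \<open>n > 1\<close>
      by simp
    then have "single \<alpha> (1::'a) = 0" by (intro ind) auto
    then show False by (metis lookup_single_eq lookup_zero zero_neq_one)
  qed
  then obtain i where i: "i \<in> {1..n}" "lookup \<alpha> i < m div a" by blast
  \<comment> \<open>The first power of \<open>x_i\<close> outside the block. No \<open>q\<close>
    supported on the block can cancel it, yet its degree is at most \<open>m div a\<close>, too
    small for a term of an element of the ideal.\<close>
  let ?u = "single i (lookup \<alpha> i + 1)"
  have keys: "keys ?u \<subseteq> {1..n}" using i(1) by simp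
  then obtain q :: "'a mpol" where q: "\<forall>t\<in>keys q. \<forall>i. lookup t i \<le> lookup \<alpha> i" "single ?u 1 - q \<in> coinv_ideal m a n"
    using span[of "single ?u 1"] by (auto simp: mpol_ring_simps)
  have "?u \<notin> keys q"
    using q(1) by (auto dest!: bspec[of _ _ ?u] spec[of _ i])
  then have "?u \<in> keys (single ?u 1 - q)"
    by (simp add: in_keys_iff lookup_minus)
  then have "m div a < mono_degree ?u"
    using coinv_ideal_degree_gt[OF assms q(2)] by blast
  also have "mono_degree ?u = lookup \<alpha> i + 1"
    by (simp add: mono_degree_def)
  finally show False using i(2) by simp
qed

section \<open>Product relations and conclusion\<close>

text \<open>With \<open>k = n + 1 - r\<close>, the bound \<open>n < r + k\<close> holds with
  difference one, so \<open>hsym m k r\<close> vanishes in the quotient; the power of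
  \<open>X k\<close> is its term with all the degree on the last variable.\<close>

lemma coinv_class_power_relation:
  assumes "m > 0" "r \<in> {1..n}"
  shows "coinv_class m a n ((X (n + 1 - r) :: 'a::comm_ring_1 mpol) ^ (m * r)) =
    coinv_class m a n (- (\<Sum>j\<in>{j \<in> tuples (n + 1 - r) r. j (n + 1 - r) \<noteq> r}.
      \<Prod>i\<in>{1..n + 1 - r}. X i ^ (m * j i)))"
proof -
  define k where "k = n + 1 - r"
  have k: "k \<ge> 1" "k \<le> n" "n < r + k" using assms(2) by (auto simp: k_def)
  let ?P = "\<lambda>j. \<Prod>i\<in>{1..k}. X i ^ (m * j i) :: 'a mpol"
  let ?S = "\<Sum>j\<in>{j \<in> tuples k r. j k \<noteq> r}. ?P j"
  \<comment> \<open>The restriction matters: tuples are extensional, so \<open>j0\<close> must be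
    \<open>undefined\<close> outside \<open>{1..k}\<close>.\<close>
  define j0 where "j0 = (\<lambda>i\<in>{1..k}. if i = k then r else 0)"
  have "{j \<in> tuples k r. j k = r} = {j0}"
  proof (intro equalityI subsetI)
    fix j assume j: "j \<in> {j \<in> tuples k r. j k = r}"
    then have "(\<Sum>i\<in>{1..k}. j i) = r" "j k = r" by (auto simp: tuples_def)
    then have "(\<Sum>i\<in>{1..k} - {k}. j i) = 0"
      using k(1) by (subst (asm) sum.remove[of _ k]) auto
    then have "j i = j0 i" for i
      using j by (cases "i \<in> {1..k}") (auto simp: j0_def tuples_def PiE_def extensional_def)
    then show "j \<in> {j0}" by auto
  next
    fix j assume "j \<in> {j0}"
    then show "j \<in> {j \<in> tuples k r. j k = r}"
      using k(1) by (auto simp: tuples_def j0_def)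
  qed
  moreover have "?P j0 = X k ^ (m * r)"
  proof -
    have "?P j0 = (\<Prod>i\<in>{1..k}. if i = k then X k ^ (m * r) else 1)"
      by (intro prod.cong) (auto simp: j0_def)
    then show ?thesis using k(1) by simp
  qed
  ultimately have "(\<Sum>j\<in>{j \<in> tuples k r. j k = r}. ?P j) = X k ^ (m * r)" by simp
  moreover have "tuples k r = {j \<in> tuples k r. j k = r} \<union> {j \<in> tuples k r. j k \<noteq> r}" by blast
  then have "(\<Sum>j\<in>tuples k r. ?P j) = (\<Sum>j\<in>{j \<in> tuples k r. j k = r}. ?P j) + ?S"
    using finite_tuples[of k r] by (subst sum.union_disjoint[symmetric]) auto
  ultimately have eq: "hsym m k r = X k ^ (m * r) - (- ?S)"
    by (simp add: hsym_eq_sum_tuples[OF assms(1)])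
  have Xk: "(X k :: 'a mpol) ^ (m * r) \<in> carrier (mpol_ring n)"
    using k by (auto simp: X_power mpol_ring_simps)
  have h: "(hsym m k r :: 'a mpol) \<in> coinv_ideal m a n"
    using k by (intro hsym_in_coinv_ideal[OF assms(1)])
  have "- ?S = X k ^ (m * r) - hsym m k r" by (simp add: eq)
  then have "- ?S \<in> carrier (mpol_ring n)"
    using mpol_minus(1)[OF Xk subsetD[OF coinv_ideal_closed(1) h]] by simp
  then show ?thesis
    using h coinvariants_simps(5)[OF Xk] unfolding k_def[symmetric] eq by blast
qed

text \<open>For \<open>n = 1\<close> the ring of coinvariants is that of polynomials in
  \<open>x_1\<close> modulo \<open>x_1^(m/a)\<close>, which has a block basis for every
  \<open>a\<close>; this is the case that \<open>n = 1 \<longrightarrow> a = 1\<close> excludes. The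
  condition that \<open>m\<close> divides \<open>q - 1\<close> supplies a primitive
  \<open>m\<close>-th root of unity.\<close>

theorem theorem4p6:
  fixes m a n :: nat
  assumes "m > 0" "a > 0" "n > 0" "a dvd m"
    and "m dvd card (UNIV :: 'a::{field,finite} set) - 1"
    and "n = 1 \<longrightarrow> a = 1"
  shows "((\<exists>f :: 'a mpol. generates_block_basis m a n f) \<longleftrightarrow> a = 1) \<and>
    (a = 1 \<longrightarrow>
       generates_block_basis m a n (\<Prod>i\<in>{1..n}. (X i :: 'a mpol) ^ (m * (n + 1 - i) - 1)) \<and>
       (\<forall>r\<in>{1..n}.
          coinv_class m a n ((X (n + 1 - r) :: 'a mpol) ^ (m * r)) =
          coinv_class m a n
            (- (\<Sum>j\<in>{j \<in> tuples (n + 1 - r) r. j (n + 1 - r) \<noteq> r}.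
                  \<Prod>i\<in>{1..n + 1 - r}. X i ^ (m * j i)))))"
proof -
  obtain \<zeta> :: 'a where \<zeta>: "\<And>k. \<zeta> ^ k = 1 \<longleftrightarrow> m dvd k"
    using exists_primitive_root_of_unity[OF assms(1,5)] by blast
  have block: "generates_block_basis m 1 n (\<Prod>i\<in>{1..n}. (X i :: 'a mpol) ^ (m * (n + 1 - i) - 1))"
    unfolding generates_block_basis_iff
  proof (intro exI[of _ "staircase m n id"] conjI allI ballI impI)
    show "keys (staircase m n id) \<subseteq> {1..n}"
      by (auto simp: in_keys_iff lookup_staircase split: if_splits)
    show "(\<Prod>i\<in>{1..n}. (X i :: 'a mpol) ^ (m * (n + 1 - i) - 1)) = single (staircase m n id) 1"
      by (simp add: X_power prod_single staircase_def)
    show "p = 0" if "(\<forall>t\<in>keys p. \<forall>i. lookup t i \<le> lookup (staircase m n id) i) \<and> p \<in> coinv_ideal m 1 n"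
      for p :: "'a mpol"
      using block_monomials_independent[OF \<zeta> assms(1)] that by blast
    show "\<exists>q. (\<forall>t\<in>keys q. \<forall>i. lookup t i \<le> lookup (staircase m n id) i) \<and> p - q \<in> coinv_ideal m 1 n"
      if "p \<in> carrier (mpol_ring n)" for p :: "'a mpol"
      using block_monomials_span[OF assms(1) that] .
  qed
  have "a = 1" if "generates_block_basis m a n f" for f :: "'a mpol"
  proof (rule ccontr)
    assume "a \<noteq> 1"
    with assms have "a > 1" "n > 1" by auto
    with no_block_basis[OF \<zeta> assms(1,4)] that show False by blast
  qed
  with block coinv_class_power_relation[OF assms(1)] show ?thesis by blast
qed

end
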